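(* The number $p_n$ of interval posets with $n$ minimal elements is \[ p_n=\begin{cases}1 & \text{if } n=1,\\[4pt] \displaystyle\frac{1}{n}\sum_{i=1}^{n-1}\ \sum_{k=0}^{\min\{i,\frac{n-i-1}{2}\}}\binom{n+i-1}{i}\binom{i}{k}\binom{n-2k-2}{i-1} & \text{if } n>1.\end{cases} \]
   Context: A permutation $\sigma=\sigma(1)\dots\sigma(n)$ of size $n$ is a word on $\{1,\dots,n\}$ containing each letter exactly once. A non-empty interval of $\sigma$ is a set of values $[j,j+h]=\{j,\dots,j+h\}$ such that $\{\sigma(i),\dots,\sigma(i+h)\}=[j,j+h]$ for some $i$. $P(\sigma)$ is the poset of all non-empty intervals of $\sigma$ (including singletons and $[1,n]$) ordered by inclusion. An interval poset is a poset of the form $P(\sigma)$; two interval posets are equal (counted once) when they are equal as sets of intervals ordered by inclusion (not merely isomorphic). $P(\sigma)$ has $n$ minimal elements (the singletons) exactly when $\sigma$ has size $n$. The inner sum runs over integers $k$ with $0\le k\le\min\{i,\frac{n-i-1}{2}\}$. *)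

theory Defs
  imports Complex_Main "HOL-Combinatorics.Permutations"
begin

text \<open>
  A permutation of size \<open>n\<close> is a function \<open>\<sigma>\<close> with \<open>\<sigma> permutes {1..n}\<close>, read as the word
  \<open>\<sigma> 1 \<dots> \<sigma> n\<close>. Such a function is the identity outside \<open>{1..n}\<close>, so the positions
  have to be bounded explicitly.
\<close>

definition intervals :: "nat \<Rightarrow> (nat \<Rightarrow> nat) \<Rightarrow> nat set set" where
  "intervals n \<sigma> = {{j..j + h} | i j h. 1 \<le> i \<and> i + h \<le> n \<and> \<sigma> ` {i..i + h} = {j..j + h}}"

text \<open>
  A poset is given by its (reflexive) order relation, as in \<^theory>\<open>HOL.Order_Relation\<close>: the
  underlying set of \<open>r\<close> is \<open>Field r\<close>. Equality of two posets is thus equality of underlying sets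
  together with equality of orders, not isomorphism.
\<close>

definition poset_of_intervals :: "nat \<Rightarrow> (nat \<Rightarrow> nat) \<Rightarrow> nat set rel" where
  "poset_of_intervals n \<sigma> = {(I, J). I \<in> intervals n \<sigma> \<and> J \<in> intervals n \<sigma> \<and> I \<subseteq> J}"

definition interval_poset :: "nat set rel \<Rightarrow> bool" where
  "interval_poset r \<longleftrightarrow> (\<exists>n \<sigma>. \<sigma> permutes {1..n} \<and> r = poset_of_intervals n \<sigma>)"

definition minimal_elements :: "'a rel \<Rightarrow> 'a set" where
  "minimal_elements r = {x \<in> Field r. \<forall>y. (y, x) \<in> r \<longrightarrow> y = x}"

definition num_interval_posets :: "nat \<Rightarrow> nat" where
  "num_interval_posets n = card {r. interval_poset r \<and> card (minimal_elements r) = n}"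

end

theory Submission
  imports Defs "HOL-Computational_Algebra.Formal_Power_Series"
begin

text \<open>
  Whether the values \<open>x, \<dots>, y - 1\<close> form an interval of a permutation depends only on the order in
  which the values occur in the word: no other value may occur between two of them. Intervals are
  therefore studied for a linear order on \<open>{a..<b}\<close>, given by an injective function \<open>\<tau>\<close> (for a
  permutation \<open>\<sigma>\<close> it is \<open>inv \<sigma>\<close>), and the interval \<open>{x..<y}\<close> is encoded as the pair \<open>(x, y)\<close>.

  Such a family of intervals is closed under union, intersection and differences of overlapping
  members, and if three adjacent members have a member as their union, then the middle one can be
  merged with one of its neighbours. These closure properties (\<open>interval_system\<close>) already force a
  tree structure. Suppose first that some point splits \<open>{a..<b}\<close> into two members. Then all such
  points together cut \<open>{a..<b}\<close> into blocks, and the members crossing a cut are exactly the unions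
  of two or more consecutive blocks: a \<^emph>\<open>linear\<close> node. If no point splits \<open>{a..<b}\<close>, the maximal proper
  members partition it, and only \<open>{a..<b}\<close> itself crosses a boundary between two of them: a
  \<^emph>\<open>prime\<close> node, which has at least four children because two would be separated by a splitting
  point and three are ruled out by the property of three adjacent members. Recursion into the
  blocks gives a plane tree (\<open>interval_system_ex_tree\<close>).

  The tree can be read off from the family (\<open>tree_intervals_inject\<close>), and every tree occurs
  (\<open>ex_order_of_tree\<close>): put the orders of the children, suitably reversed, one after another
  at a linear node, and arrange them like a simple permutation at a prime node. So interval posets with \<open>n\<close> minimal
  elements correspond to plane trees with \<open>n\<close> leaves in which a node with \<open>k\<close> children comes in
  \<open>w\<^sub>k\<close> types, where \<open>w\<^sub>2 = w\<^sub>3 = 1\<close> and \<open>w\<^sub>k = 2\<close> for \<open>k \<ge> 4\<close>. Their generating function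
  satisfies \<open>P = X + (\<Sum>k. w\<^sub>k P\<^sup>k)\<close>. As \<open>X - (\<Sum>k. w\<^sub>k X\<^sup>k) = X (1 - V)\<close> with
  \<open>V = X (1 + X\<^sup>2) / (1 - X)\<close>, Lagrange inversion shows that \<open>n p\<^sub>n\<close> is the coefficient of
  \<open>X\<^bsup>n-1\<^esup>\<close> in \<open>(1 - V)\<^bsup>-n\<^esup>\<close>. The sum over \<open>i\<close> comes from expanding this in powers of \<open>V\<close>, the
  sum over \<open>k\<close> from expanding \<open>(1 + X\<^sup>2)\<^sup>i\<close>, and the last binomial coefficient is a coefficient of
  \<open>(1 - X)\<^bsup>-i\<^esup>\<close>.
\<close>

section \<open>Decomposition trees\<close>

datatype node_kind = Linear | Prime

datatype dtree = Leaf | Node node_kind "dtree list"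

primrec leaves :: "dtree \<Rightarrow> nat" where
  "leaves Leaf = 1"
| "leaves (Node \<kappa> ts) = sum_list (map leaves ts)"

text \<open>
  There is no simple permutation of size 3, and for two children the two kinds of node would have
  the same intervals.
\<close>

primrec min_arity :: "node_kind \<Rightarrow> nat" where
  "min_arity Linear = 2"
| "min_arity Prime = 4"

primrec valid :: "dtree \<Rightarrow> bool" where
  "valid Leaf = True"
| "valid (Node \<kappa> ts) = (min_arity \<kappa> \<le> length ts \<and> (\<forall>v \<in> set (map valid ts). v))"

text \<open>
  The blocks of the children of a node whose values start at \<open>a\<close> are the sets
  \<open>{cut a ts i..<cut a ts (Suc i)}\<close>.
\<close>

definition cut :: "nat \<Rightarrow> dtree list \<Rightarrow> nat \<Rightarrow> nat" where
  "cut a ts i = a + sum_list (map leaves (take i ts))"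

text \<open>
  The intervals contributed by a node itself, where \<open>c\<close> lists the boundaries of its \<open>k\<close> blocks.
  The linear case includes the single blocks; these occur among the intervals of the
  children as well.
\<close>

primrec node_intervals :: "node_kind \<Rightarrow> (nat \<Rightarrow> nat) \<Rightarrow> nat \<Rightarrow> (nat \<times> nat) set" where
  "node_intervals Linear c k = {(c i, c j) | i j. i < j \<and> j \<le> k}"
| "node_intervals Prime c k = {(c 0, c k)}"

primrec tree_intervals :: "dtree \<Rightarrow> nat \<Rightarrow> (nat \<times> nat) set" where
  "tree_intervals Leaf a = {(a, Suc a)}"
| "tree_intervals (Node \<kappa> ts) a =
     (\<Union>i<length ts. (map tree_intervals ts ! i) (cut a ts i)) \<union> node_intervals \<kappa> (cut a ts) (length ts)"

lemma tree_intervals_Node: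
  "tree_intervals (Node \<kappa> ts) a =
     (\<Union>i<length ts. tree_intervals (ts ! i) (cut a ts i)) \<union> node_intervals \<kappa> (cut a ts) (length ts)"
  by simp

declare tree_intervals.simps(2) [simp del]

lemma node_intervals_cong:
  assumes "\<And>i. i \<le> k \<Longrightarrow> c i = d i"
  shows "node_intervals \<kappa> c k = node_intervals \<kappa> d k"
proof (cases \<kappa>)
  case Linear
  have "p = (c i, c j) \<and> i < j \<and> j \<le> k \<longleftrightarrow> p = (d i, d j) \<and> i < j \<and> j \<le> k" for p i j
    using assms[of i] assms[of j] by auto
  with Linear show ?thesis by simp
qed (simp add: assms)

lemma leaves_pos: "valid t \<Longrightarrow> leaves t \<ge> 1"
proof (induction t)
  case (Node \<kappa> ts)
  then have "ts \<noteq> []" by (cases \<kappa>) auto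
  then obtain t ts' where "ts = t # ts'" by (cases ts) auto
  with Node show ?case by (auto simp: trans_le_add1)
qed simp

lemma cut_0 [simp]: "cut a ts 0 = a"
  and cut_Suc: "i < length ts \<Longrightarrow> cut a ts (Suc i) = cut a ts i + leaves (ts ! i)"
  and cut_length [simp]: "cut a ts (length ts) = a + leaves (Node \<kappa> ts)"
  by (simp_all add: cut_def take_Suc_conv_app_nth)

lemma strict_mono_on_atMostI:
  fixes c :: "nat \<Rightarrow> nat"
  assumes "\<And>i. i < k \<Longrightarrow> c i < c (Suc i)"
  shows "strict_mono_on {..k} c"
proof (rule strict_mono_onI)
  fix i j assume "i \<in> {..k}" "j \<in> {..k}" "i < j"
  then show "c i < c j"
  proof (induction j)
    case (Suc j)
    then show ?case using assms[of j] by (cases "i = j") auto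
  qed simp
qed

lemma strict_mono_on_less_iff:
  fixes c :: "nat \<Rightarrow> nat"
  assumes "strict_mono_on {..k} c" "i \<le> k" "j \<le> k"
  shows "c i < c j \<longleftrightarrow> i < j" and "c i \<le> c j \<longleftrightarrow> i \<le> j" and "c i = c j \<longleftrightarrow> i = j"
proof -
  have less: "c i < c j" if "i < j" "i \<le> k" "j \<le> k" for i j
    using assms(1) that by (auto simp: strict_mono_on_def)
  show "c i < c j \<longleftrightarrow> i < j" "c i \<le> c j \<longleftrightarrow> i \<le> j" "c i = c j \<longleftrightarrow> i = j"
    using less[of i j] less[of j i] assms(2,3) by (cases i j rule: linorder_cases; force)+
qed

lemma strict_mono_cut:
  assumes "\<forall>t \<in> set ts. valid t"
  shows "strict_mono_on {..length ts} (cut a ts)"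
proof (rule strict_mono_on_atMostI)
  fix i assume "i < length ts"
  then show "cut a ts i < cut a ts (Suc i)"
    using assms leaves_pos[of "ts ! i"] by (simp add: cut_Suc)
qed

lemma ex_block:
  fixes c :: "nat \<Rightarrow> nat"
  assumes "c 0 \<le> x" "x < c k"
  shows "\<exists>i<k. c i \<le> x \<and> x < c (Suc i)"
  using assms
proof (induction k)
  case (Suc k)
  then show ?case by (cases "x < c k") (auto intro: less_SucI)
qed simp

lemma block_unique:
  fixes c :: "nat \<Rightarrow> nat"
  assumes "strict_mono_on {..k} c" "i < k" "j < k" "c i \<le> x" "x < c (Suc i)" "c j \<le> x" "x < c (Suc j)"
  shows "i = j"
proof -
  have "c i < c (Suc j)" "c j < c (Suc i)" using assms by linarith+
  then show ?thesis using assms strict_mono_on_less_iff(1)[OF assms(1)] by (simp add: less_Suc_eq_le)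
qed

text \<open>
  The boundaries of the blocks are determined by the set of boundaries, since an increasing
  enumeration is unique.
\<close>

lemma strict_mono_on_image_unique:
  fixes c d :: "nat \<Rightarrow> nat"
  assumes "strict_mono_on {..k} c" "strict_mono_on {..l} d" "c ` {..k} = d ` {..l}"
  shows "k = l" and "\<And>i. i \<le> k \<Longrightarrow> c i = d i"
proof -
  have sorted: "sorted (map f [0..<Suc m]) \<and> distinct (map f [0..<Suc m])"
    if "strict_mono_on {..m} f" for f :: "nat \<Rightarrow> nat" and m
  proof -
    have "sorted_wrt (<) (map f [0..<Suc m])"
      unfolding sorted_wrt_map
      by (rule sorted_wrt_mono_rel[OF _ sorted_wrt_upt]) (use that in \<open>auto simp: strict_mono_on_def\<close>)
    then show ?thesis by (simp only: strict_sorted_iff)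
  qed
  have set: "set (map f [0..<Suc m]) = f ` {..m}" for f :: "nat \<Rightarrow> nat" and m
    by (auto simp: image_iff simp del: upt_Suc)
  have eq: "map c [0..<Suc k] = map d [0..<Suc l]"
    by (rule sorted_distinct_set_unique) (use sorted[OF assms(1)] sorted[OF assms(2)] set assms(3) in metis)+
  then have "length (map c [0..<Suc k]) = length (map d [0..<Suc l])" by (rule arg_cong)
  then show kl: "k = l" by (simp del: upt_Suc)
  show "c i = d i" if "i \<le> k" for i
    using arg_cong[OF eq, of "\<lambda>xs. xs ! i"] that kl by (simp del: upt_Suc)
qed

lemma ex_enumeration:
  fixes S :: "nat set"
  assumes "finite S" "S \<noteq> {}"
  shows "\<exists>c. strict_mono_on {..card S - 1} c \<and> c ` {..card S - 1} = S"
proof (intro exI conjI)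
  let ?l = "sorted_list_of_set S"
  have card: "card S > 0" using assms by (simp add: card_gt_0_iff)
  show "strict_mono_on {..card S - 1} (\<lambda>i. ?l ! i)"
    using card assms strict_sorted_list_of_set[of S]
    by (intro strict_mono_onI) (auto simp: sorted_wrt_iff_nth_less)
  have "(\<lambda>i. ?l ! i) ` {..<card S} = set ?l"
    using assms by (auto simp: set_conv_nth)
  moreover have "{..<card S} = {..card S - 1}" using card by auto
  ultimately show "(\<lambda>i. ?l ! i) ` {..card S - 1} = S" using assms by simp
qed

section \<open>Interval systems are represented by decomposition trees\<close>

text \<open>
  The properties shared by the interval families of all linear orders. Without the last one, a
  node with three children whose only proper intervals lie inside the children would be possible.
\<close>

locale interval_system =
  fixes F :: "(nat \<times> nat) set" and a b :: nat
  assumes bounds: "(x, y) \<in> F \<Longrightarrow> a \<le> x \<and> x < y \<and> y \<le> b"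
    and whole: "(a, b) \<in> F"
    and singleton: "a \<le> x \<Longrightarrow> x < b \<Longrightarrow> (x, Suc x) \<in> F"
    and overlap: "(x, y) \<in> F \<Longrightarrow> (x', y') \<in> F \<Longrightarrow> x < x' \<Longrightarrow> x' < y \<Longrightarrow> y < y' \<Longrightarrow>
      (x, y') \<in> F \<and> (x', y) \<in> F \<and> (x, x') \<in> F \<and> (y, y') \<in> F"
    and triple: "(x, y) \<in> F \<Longrightarrow> (y, z) \<in> F \<Longrightarrow> (z, w) \<in> F \<Longrightarrow> (x, w) \<in> F \<Longrightarrow>
      (x, z) \<in> F \<or> (y, w) \<in> F"
begin

lemma restrict:
  assumes "(u, v) \<in> F"
  shows "interval_system (F \<inter> {(x, y). u \<le> x \<and> y \<le> v}) u v"
proof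
  show "(x, y') \<in> F \<inter> {(x, y). u \<le> x \<and> y \<le> v} \<and> (x', y) \<in> F \<inter> {(x, y). u \<le> x \<and> y \<le> v} \<and>
      (x, x') \<in> F \<inter> {(x, y). u \<le> x \<and> y \<le> v} \<and> (y, y') \<in> F \<inter> {(x, y). u \<le> x \<and> y \<le> v}"
    if "(x, y) \<in> F \<inter> {(x, y). u \<le> x \<and> y \<le> v}" "(x', y') \<in> F \<inter> {(x, y). u \<le> x \<and> y \<le> v}"
      "x < x'" "x' < y" "y < y'" for x y x' y'
    using overlap[of x y x' y'] that by auto
  show "(x, z) \<in> F \<inter> {(x, y). u \<le> x \<and> y \<le> v} \<or> (y, w) \<in> F \<inter> {(x, y). u \<le> x \<and> y \<le> v}"
    if "(x, y) \<in> F \<inter> {(x, y). u \<le> x \<and> y \<le> v}" "(y, z) \<in> F \<inter> {(x, y). u \<le> x \<and> y \<le> v}"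
      "(z, w) \<in> F \<inter> {(x, y). u \<le> x \<and> y \<le> v}" "(x, w) \<in> F \<inter> {(x, y). u \<le> x \<and> y \<le> v}" for x y z w
    using triple[of x y z w] that bounds[of x y] bounds[of y z] bounds[of z w] by auto
  show "(x, Suc x) \<in> F \<inter> {(x, y). u \<le> x \<and> y \<le> v}" if "u \<le> x" "x < v" for x
    using singleton[of x] bounds[OF assms] that by auto
qed (use assms bounds in auto)

text \<open>
  The candidates for the boundaries of the blocks: \<open>split_points\<close> at a linear root and
  \<open>uncrossed_points\<close> at a prime root.
\<close>

definition split_points :: "nat set" where
  "split_points = {x. a < x \<and> x < b \<and> (a, x) \<in> F \<and> (x, b) \<in> F}"

definition uncrossed_points :: "nat set" where
  "uncrossed_points = {x. a < x \<and> x < b \<and> (\<forall>u v. (u, v) \<in> F \<longrightarrow> u < x \<longrightarrow> x < v \<longrightarrow> (u, v) = (a, b))}"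

lemma between_split_points:
  assumes "u \<in> insert a (insert b split_points)" "v \<in> insert a (insert b split_points)" "u < v"
  shows "(u, v) \<in> F"
proof -
  have "u \<le> b" "v \<le> b" "a \<le> u" "a \<le> v"
    using assms(1,2) bounds[OF whole] by (auto simp: split_points_def)
  then have "u = a \<or> u \<in> split_points" "v = b \<or> v \<in> split_points"
    using assms by auto
  then show ?thesis
    using assms(3) whole overlap[of a v u b] by (auto simp: split_points_def)
qed

lemma crossing_split_point:
  assumes "(u, v) \<in> F" "x \<in> split_points" "u < x" "x < v"
  shows "u \<in> insert a split_points" "v \<in> insert b split_points"
proof -
  have x: "(a, x) \<in> F" "(x, b) \<in> F" and uv: "a \<le> u" "v \<le> b"
    using assms(2) bounds[OF assms(1)] by (auto simp: split_points_def)
  have left: "(a, u) \<in> F" "(a, v) \<in> F" if "a < u"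
    using overlap[OF x(1) assms(1) that] assms by auto
  have right: "(u, b) \<in> F" "(v, b) \<in> F" if "v < b"
    using overlap[OF assms(1) x(2)] that assms by auto
  have "(a, v) \<in> F" "(u, b) \<in> F"
    using left right uv assms(1) by (cases "a = u"; cases "v = b"; simp)+
  then show "u \<in> insert a split_points" "v \<in> insert b split_points"
    using left right uv assms(3,4) by (auto simp: split_points_def)
qed

text \<open>
  The interval of a prime root that starts at the boundary \<open>u\<close> is the longest proper member starting
  there. Its end is a boundary again: a proper member crossing this end cannot start before \<open>u\<close>, as it
  would cross \<open>u\<close>, nor at \<open>u\<close>, by maximality; and if it starts later, the union of the two intervals is
  longer, hence equal to \<open>{a..<b}\<close>, and its start is a split point.
\<close>

lemma next_uncrossed_point:
  assumes "split_points = {}" "Suc a < b" "u \<in> insert a uncrossed_points"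
  shows "\<exists>v \<in> insert b uncrossed_points. (u, v) \<in> F \<and> (u, v) \<noteq> (a, b)"
proof -
  have u: "a \<le> u" "u < b" using assms by (auto simp: uncrossed_points_def)
  define Y where "Y = {y. (u, y) \<in> F \<and> (u, y) \<noteq> (a, b)}"
  have "Suc u \<in> Y" using u singleton assms(2) by (auto simp: Y_def)
  moreover have fin: "finite Y"
    by (rule finite_subset[of _ "{..b}"]) (use bounds in \<open>auto simp: Y_def\<close>)
  ultimately have Max: "Max Y \<in> Y" by (intro Max_in) auto
  define v where "v = Max Y"
  have v: "(u, v) \<in> F" "(u, v) \<noteq> (a, b)" "u < v" "v \<le> b"
    using Max bounds by (auto simp: v_def Y_def)
  have max: "y \<le> v" if "(u, y) \<in> F" "(u, y) \<noteq> (a, b)" for y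
    unfolding v_def using that fin by (intro Max_ge) (auto simp: Y_def)
  have "(s, t) = (a, b)" if st: "(s, t) \<in> F" "s < v" "v < t" for s t
  proof (rule ccontr)
    assume ne: "(s, t) \<noteq> (a, b)"
    consider "s < u" | "s = u" | "u < s" by linarith
    then show False
    proof cases
      case 1
      then show False using assms(3) st ne v bounds[OF st(1)] by (auto simp: uncrossed_points_def)
    next
      case 2
      then show False using max[of t] st ne by auto
    next
      case 3
      then have o: "(u, t) \<in> F" "(u, s) \<in> F" using overlap[OF v(1) st(1)] st by auto
      with max[of t] st(3) have "u = a" "t = b" by auto
      with o(2) 3 st v have "s \<in> split_points" by (auto simp: split_points_def)
      with assms(1) show False by simp
    qed
  qed
  then have "v \<in> insert b uncrossed_points"
    using v u by (auto simp: uncrossed_points_def)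
  with v show ?thesis by blast
qed

lemma consecutive_uncrossed_points:
  assumes "split_points = {}" "Suc a < b" "u \<in> insert a uncrossed_points" "v \<in> insert b uncrossed_points" "u < v"
    and "\<forall>x \<in> uncrossed_points. \<not> (u < x \<and> x < v)"
  shows "(u, v) \<in> F"
proof -
  obtain v' where v': "v' \<in> insert b uncrossed_points" "(u, v') \<in> F" "(u, v') \<noteq> (a, b)"
    using next_uncrossed_point[OF assms(1-3)] by blast
  note b = bounds[OF v'(2)]
  have "\<not> v < v'"
  proof
    assume "v < v'"
    then have "v \<in> uncrossed_points" using assms(4) b by auto
    then have "(u, v') = (a, b)" using v'(2) assms(5) \<open>v < v'\<close> by (simp add: uncrossed_points_def)
    with v'(3) show False by simp
  qed
  moreover have "\<not> v' < v"
  proof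
    assume "v' < v"
    moreover have "v \<le> b" using assms(4) by (auto simp: uncrossed_points_def)
    ultimately have "v' \<in> uncrossed_points" using v'(1) by auto
    with assms(6) b \<open>v' < v\<close> show False by auto
  qed
  ultimately have "v' = v" by simp
  with v' show ?thesis by simp
qed

end

lemma ex_tree_of_blocks:
  assumes mono: "strict_mono_on {..k} c" and ends: "c 0 = a" "c k = b"
    and arity: "min_arity \<kappa> \<le> k"
    and blocks: "\<And>i. i < k \<Longrightarrow> \<exists>t. valid t \<and> leaves t = c (Suc i) - c i \<and> tree_intervals t (c i) = G i"
  shows "\<exists>t. valid t \<and> leaves t = b - a \<and> tree_intervals t a = (\<Union>i<k. G i) \<union> node_intervals \<kappa> c k"
proof -
  obtain f where f: "\<And>i. i < k \<Longrightarrow> valid (f i) \<and> leaves (f i) = c (Suc i) - c i \<and> tree_intervals (f i) (c i) = G i"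
    using blocks by metis
  define ts where "ts = map f [0..<k]"
  have nth: "length ts = k" "\<And>i. i < k \<Longrightarrow> ts ! i = f i" by (simp_all add: ts_def)
  have cut: "cut a ts i = c i" if "i \<le> k" for i
    using that
  proof (induction i)
    case (Suc i)
    then have "c i < c (Suc i)" using strict_mono_on_less_iff(1)[OF mono, of i "Suc i"] by simp
    with Suc f[of i] nth show ?case by (simp add: cut_Suc)
  qed (simp add: ends)
  have "valid (Node \<kappa> ts)" using arity f by (auto simp: ts_def)
  moreover have "leaves (Node \<kappa> ts) = b - a"
    using cut_length[of a ts \<kappa>] cut[of k] ends nth by simp
  moreover have "node_intervals \<kappa> (cut a ts) k = node_intervals \<kappa> c k"
    by (rule node_intervals_cong) (rule cut)
  then have "tree_intervals (Node \<kappa> ts) a = (\<Union>i<k. G i) \<union> node_intervals \<kappa> c k"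
    using f cut nth by (simp add: tree_intervals_Node)
  ultimately show ?thesis by blast
qed

text \<open>
  The root is linear exactly if there are split points. Its boundaries are collected in \<open>S\<close> and
  enumerated by \<open>c\<close>. Members that cross a boundary belong to the root, all others lie in one block and
  are covered by the induction hypothesis.
\<close>

theorem interval_system_ex_tree:
  assumes "interval_system F a b"
  shows "\<exists>t. valid t \<and> leaves t = b - a \<and> tree_intervals t a = F"
  using assms
proof (induction "b - a" arbitrary: F a b rule: less_induct)
  case less
  interpret interval_system F a b by fact
  have ab: "a < b" using bounds[OF whole] by simp
  show ?case
  proof (cases "Suc a = b")
    case True
    have "F = {(a, Suc a)}"
      using whole bounds True by (auto; force)
    then show ?thesis using True by (intro exI[of _ Leaf]) auto
  next
    case False
    then have ab2: "Suc a < b" using ab by simp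
    define \<kappa> where "\<kappa> = (if split_points = {} then Prime else Linear)"
    define C where "C = (if split_points = {} then uncrossed_points else split_points)"
    define S where "S = insert a (insert b C)"
    have C: "C \<subseteq> {a<..<b}" by (auto simp: C_def split_points_def uncrossed_points_def)
    then have finC: "finite C" by (rule finite_subset) simp
    have uncrossed: "(u, v) = (a, b)" if "split_points = {}" "e \<in> C" "(u, v) \<in> F" "u < e" "e < v" for u v e
      using that by (simp add: C_def uncrossed_points_def)
    define k where "k = card S - 1"
    have card: "card S = Suc (Suc (card C))"
      using C finC ab by (auto simp: S_def card_insert_if)
    have finS: "finite S" "S \<noteq> {}" using finC by (auto simp: S_def)
    obtain c where mono: "strict_mono_on {..k} c" and img: "c ` {..k} = S"
      using ex_enumeration[OF finS] by (auto simp: k_def)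
    note c_less = strict_mono_on_less_iff[OF mono]
    have S_bounds: "a \<le> x \<and> x \<le> b" if "x \<in> S" for x using that C ab by (auto simp: S_def)
    have c_in: "c i \<in> S" if "i \<le> k" for i using img that by auto
    have c0: "c 0 = a"
    proof -
      obtain i where "i \<le> k" "c i = a" using img S_def by (metis imageE atMost_iff insertCI)
      then show ?thesis using c_less(2)[of 0 i] S_bounds[OF c_in[of 0]] by simp
    qed
    have ck: "c k = b"
    proof -
      obtain i where "i \<le> k" "c i = b" using img S_def by (metis imageE atMost_iff insertCI)
      then show ?thesis using c_less(2)[of i k] S_bounds[OF c_in[of k]] by simp
    qed
    have gap: "\<not> (c i < x \<and> x < c (Suc i))" if "i < k" "x \<in> S" for i x
    proof
      assume x: "c i < x \<and> x < c (Suc i)"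
      obtain j where j: "j \<le> k" "x = c j" using img \<open>x \<in> S\<close> by auto
      show False using x c_less(1)[of i j] c_less(1)[of j "Suc i"] j \<open>i < k\<close> by auto
    qed
    have gap_in: "(c i, c (Suc i)) \<in> F" if "i < k" for i
    proof -
      have lt: "c i < c (Suc i)" using c_less(1)[of i "Suc i"] that by simp
      have in_S: "c i \<in> S" "c (Suc i) \<in> S" using c_in that by auto
      show ?thesis
      proof (cases "split_points = {}")
        case True
        have "c i \<noteq> b" "c (Suc i) \<noteq> a" using lt S_bounds[OF in_S(1)] S_bounds[OF in_S(2)] by auto
        with True in_S lt gap[OF that] show ?thesis
          by (intro consecutive_uncrossed_points ab2) (auto simp: S_def C_def)
      next
        case False
        with in_S lt show ?thesis by (intro between_split_points) (auto simp: S_def C_def)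
      qed
    qed
    have k: "min_arity \<kappa> \<le> k"
    proof (cases "split_points = {}")
      case False
      then have "card C \<noteq> 0" using finC by (simp add: C_def)
      then show ?thesis using card False by (simp add: k_def \<kappa>_def)
    next
      case True
      have in_C: "c i \<in> C" if "0 < i" "i < k" for i
        using c_in[of i] that c_less(3)[of i 0] c_less(3)[of i k] c0 ck by (auto simp: S_def)
      have k1: "k \<ge> 1" using card by (simp add: k_def)
      \<comment> \<open>one block would be all of \<open>{a..<b}\<close>, two blocks give a split point, and for three blocks
        \<open>triple\<close> gives a proper member crossing a boundary\<close>
      have "k \<noteq> 1"
      proof
        assume "k = 1"
        then have "C = {}" using card finC by (simp add: k_def)
        then show False using next_uncrossed_point[OF True ab2, of a] True by (auto simp: C_def)
      qed
      moreover have "k \<noteq> 2"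
      proof
        assume k: "k = 2"
        then have "c 1 \<in> split_points"
          using gap_in[of 0] gap_in[of 1] bounds[of "c 0" "c 1"] bounds[of "c 1" "c 2"] c0 ck
          by (auto simp: split_points_def numeral_2_eq_2)
        then show False using True by simp
      qed
      moreover have "k \<noteq> 3"
      proof
        assume k: "k = 3"
        have 3: "(c 0, c 1) \<in> F" "(c 1, c 2) \<in> F" "(c 2, c 3) \<in> F"
          using gap_in[of 0] gap_in[of 1] gap_in[of 2] k by (simp_all add: numeral_eq_Suc)
        then have "(c 0, c 2) \<in> F \<or> (c 1, c 3) \<in> F"
          using triple[OF 3] whole c0 ck k by simp
        moreover have "c 1 \<in> C" "c 2 \<in> C" using in_C k by auto
        moreover have "c 0 < c 1" "c 1 < c 2" "c 2 < c 3" using bounds 3 by blast+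
        ultimately show False
          using uncrossed[OF True, of "c 1" "c 0" "c 2"] uncrossed[OF True, of "c 2" "c 1" "c 3"] c0 ck k
          by auto
      qed
      ultimately show ?thesis using k1 True by (simp add: \<kappa>_def)
    qed
    define G where "G i = F \<inter> {(x, y). c i \<le> x \<and> y \<le> c (Suc i)}" for i
    have "k > 1" using k by (cases \<kappa>) auto
    have IH: "\<exists>t. valid t \<and> leaves t = c (Suc i) - c i \<and> tree_intervals t (c i) = G i" if "i < k" for i
    proof (rule less.hyps)
      have "c i < c (Suc i)" "a \<le> c i" "c (Suc i) \<le> b" "c i \<noteq> a \<or> c (Suc i) \<noteq> b"
        using c_less(1)[of i "Suc i"] that S_bounds[OF c_in[of i]] S_bounds[OF c_in[of "Suc i"]]
          c_less(3)[of i 0] c_less(3)[of "Suc i" k] c0 ck \<open>k > 1\<close>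
        by auto
      then show "c (Suc i) - c i < b - a" by linarith
      show "interval_system (G i) (c i) (c (Suc i))"
        unfolding G_def by (rule restrict) (rule gap_in[OF that])
    qed
    have "F = (\<Union>i<k. G i) \<union> node_intervals \<kappa> c k"
    proof (intro equalityI subrelI)
      fix x y assume xy: "(x, y) \<in> F"
      note b = bounds[OF xy]
      show "(x, y) \<in> (\<Union>i<k. G i) \<union> node_intervals \<kappa> c k"
      proof (cases "\<exists>e \<in> C. x < e \<and> e < y")
        case True
        then obtain e where e: "e \<in> C" "x < e" "e < y" by blast
        have "(x, y) \<in> node_intervals \<kappa> c k"
        proof (cases "split_points = {}")
          case True
          then have "(x, y) = (a, b)" using uncrossed e xy by blast
          then show ?thesis using True c0 ck by (simp add: \<kappa>_def)
        next
          case False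
          then have "x \<in> S" "y \<in> S" using crossing_split_point[OF xy, of e] e by (auto simp: S_def C_def)
          then obtain i j where "i \<le> k" "j \<le> k" "x = c i" "y = c j" using img by blast
          moreover from this have "i < j" using c_less(1) b by auto
          ultimately show ?thesis using False by (auto simp: \<kappa>_def)
        qed
        then show ?thesis by blast
      next
        case False
        obtain i where i: "i < k" "c i \<le> x" "x < c (Suc i)"
          using ex_block[of c x k] b c0 ck by auto
        have "y \<le> c (Suc i)"
        proof (rule ccontr)
          assume "\<not> y \<le> c (Suc i)"
          moreover have "c (Suc i) \<in> S" using c_in i by simp
          ultimately show False using False i b by (auto simp: S_def)
        qed
        then show ?thesis using i xy by (auto simp: G_def)
      qed
    next
      fix x y assume "(x, y) \<in> (\<Union>i<k. G i) \<union> node_intervals \<kappa> c k"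
      moreover have "(x, y) \<in> F" if "(x, y) \<in> node_intervals \<kappa> c k"
      proof (cases "split_points = {}")
        case True
        then show ?thesis using that whole c0 ck by (simp add: \<kappa>_def)
      next
        case False
        then have "\<kappa> = Linear" by (simp add: \<kappa>_def)
        then obtain i j where "i < j" "j \<le> k" "x = c i" "y = c j" using \<open>(x, y) \<in> node_intervals \<kappa> c k\<close> by auto
        moreover from this have "x < y" "x \<in> S" "y \<in> S" using c_less(1) c_in by auto
        ultimately show ?thesis using False by (intro between_split_points) (auto simp: S_def C_def)
      qed
      ultimately show "(x, y) \<in> F" by (auto simp: G_def)
    qed
    with ex_tree_of_blocks[OF mono c0 ck k IH] show ?thesis by simp
  qed
qed

section \<open>The tree is determined by its intervals\<close>

lemma cut_le_leaves:
  assumes "\<forall>t \<in> set ts. valid t" "i \<le> length ts"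
  shows "a \<le> cut a ts i" "cut a ts i \<le> a + leaves (Node \<kappa> ts)"
proof -
  note le = strict_mono_on_less_iff(2)[OF strict_mono_cut[OF assms(1), of a]]
  show "a \<le> cut a ts i" using le[of 0 i] assms(2) by simp
  show "cut a ts i \<le> a + leaves (Node \<kappa> ts)"
    using le[of i "length ts"] assms(2) cut_length[of a ts \<kappa>] by simp
qed

lemma valid_NodeD:
  assumes "valid (Node \<kappa> ts)"
  shows "\<forall>t \<in> set ts. valid t" "min_arity \<kappa> \<le> length ts" "length ts \<ge> 2" "ts \<noteq> []"
  using assms by (cases \<kappa>; auto)+

lemma leaves_Node:
  assumes "valid (Node \<kappa> ts)"
  shows "leaves (Node \<kappa> ts) \<ge> 2"
proof -
  obtain t t' ts' where ts: "ts = t # t' # ts'"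
    using valid_NodeD(3)[OF assms] by (auto simp: numeral_2_eq_2 Suc_le_length_iff)
  have "leaves t \<ge> 1" "leaves t' \<ge> 1"
    using valid_NodeD(1)[OF assms] leaves_pos by (auto simp: ts)
  then show ?thesis by (simp add: ts)
qed

lemma node_intervals_bounds:
  assumes "strict_mono_on {..k} c" "k > 0" "(x, y) \<in> node_intervals \<kappa> c k"
  shows "c 0 \<le> x \<and> x < y \<and> y \<le> c k"
proof -
  obtain i j where "i < j" "j \<le> k" "x = c i" "y = c j" using assms(2,3) by (cases \<kappa>) auto
  then show ?thesis
    using strict_mono_on_less_iff(2)[OF assms(1), of 0 i] strict_mono_on_less_iff(2)[OF assms(1), of j k]
      strict_mono_on_less_iff(1)[OF assms(1), of i j] by simp
qed

lemma tree_intervals_bounds: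
  assumes "valid t" "(x, y) \<in> tree_intervals t a"
  shows "a \<le> x \<and> x < y \<and> y \<le> a + leaves t"
  using assms
proof (induction t arbitrary: a)
  case (Node \<kappa> ts)
  note v = valid_NodeD[OF Node.prems(1)]
  let ?c = "cut a ts"
  from Node.prems(2) consider
      i where "i < length ts" "(x, y) \<in> tree_intervals (ts ! i) (?c i)"
    | "(x, y) \<in> node_intervals \<kappa> ?c (length ts)"
    by (auto simp: tree_intervals_Node)
  then show ?case
  proof cases
    case 1
    then have "?c i \<le> x \<and> x < y \<and> y \<le> ?c i + leaves (ts ! i)"
      using v(1) by (intro Node.IH) auto
    moreover have "?c i + leaves (ts ! i) = ?c (Suc i)" using 1 by (simp add: cut_Suc)
    ultimately show ?thesis
      using cut_le_leaves(1)[OF v(1), of i a] cut_le_leaves(2)[OF v(1), of "Suc i" a \<kappa>] 1 by auto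
  next
    case 2
    then show ?thesis
      using node_intervals_bounds[OF strict_mono_cut[OF v(1)] _ 2] v(4) cut_length[of a ts \<kappa>] by auto
  qed
qed auto

lemma whole_in_tree_intervals:
  assumes "valid t"
  shows "(a, a + leaves t) \<in> tree_intervals t a"
proof (cases t)
  case (Node \<kappa> ts)
  note v = valid_NodeD[OF assms[unfolded Node]]
  have "(cut a ts 0, cut a ts (length ts)) \<in> node_intervals \<kappa> (cut a ts) (length ts)"
  proof (cases \<kappa>)
    case Linear
    then show ?thesis using v(4) by (auto simp del: cut_0)
  qed simp
  then show ?thesis using Node cut_length[of a ts \<kappa>] by (simp add: tree_intervals_Node)
qed simp

lemma leaves_eq_if_tree_intervals_eq:
  assumes "valid t" "valid t'" "tree_intervals t a = tree_intervals t' a"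
  shows "leaves t = leaves t'"
proof -
  have "leaves t \<le> leaves t'" if "valid t" "valid t'" "tree_intervals t a = tree_intervals t' a" for t t'
    using whole_in_tree_intervals[OF that(1), of a] tree_intervals_bounds[OF that(2), of a "a + leaves t" a] that(3)
    by simp
  from this[of t t'] this[of t' t] show ?thesis using assms by simp
qed

text \<open>
  One node of a tree, seen from outside: its own intervals together with families \<open>G i\<close> living
  on its blocks. The aim is to recover all of this data from the resulting family \<open>F\<close>.
\<close>

locale block_family =
  fixes \<kappa> :: node_kind and k :: nat and c :: "nat \<Rightarrow> nat" and G :: "nat \<Rightarrow> (nat \<times> nat) set"
    and F :: "(nat \<times> nat) set"
  assumes mono: "strict_mono_on {..k} c" and arity: "min_arity \<kappa> \<le> k"
    and block_bounds: "\<And>i x y. i < k \<Longrightarrow> (x, y) \<in> G i \<Longrightarrow> c i \<le> x \<and> x < y \<and> y \<le> c (Suc i)"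
    and block_whole: "\<And>i. i < k \<Longrightarrow> (c i, c (Suc i)) \<in> G i"
    and F: "F = (\<Union>i<k. G i) \<union> node_intervals \<kappa> c k"
begin

lemmas c_less = strict_mono_on_less_iff[OF mono]

lemma k: "k \<ge> 2"
  using arity by (cases \<kappa>) auto

lemma F_cases:
  assumes "(x, y) \<in> F"
  obtains (block) i where "i < k" "(x, y) \<in> G i" "c i \<le> x" "y \<le> c (Suc i)"
  | (node) i j where "i < j" "j \<le> k" "x = c i" "y = c j" "(x, y) \<in> node_intervals \<kappa> c k"
proof (cases "(x, y) \<in> node_intervals \<kappa> c k")
  case True
  then have "\<exists>i j. i < j \<and> j \<le> k \<and> x = c i \<and> y = c j"
  proof (cases \<kappa>)
    case Prime
    then show ?thesis using True k by (intro exI[of _ 0] exI[of _ k]) simp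
  qed auto
  then show ?thesis using True node by blast
next
  case False
  then obtain i where "i < k" "(x, y) \<in> G i" using assms F by blast
  then show ?thesis using block block_bounds by blast
qed

lemma F_less: "(x, y) \<in> F \<Longrightarrow> x < y"
  by (erule F_cases) (use block_bounds c_less in auto)

lemma restrict_block:
  assumes "i < k"
  shows "F \<inter> {(x, y). c i \<le> x \<and> y \<le> c (Suc i)} = G i"
proof (intro equalityI subrelI)
  fix x y assume "(x, y) \<in> F \<inter> {(x, y). c i \<le> x \<and> y \<le> c (Suc i)}"
  then have xy: "(x, y) \<in> F" "c i \<le> x" "y \<le> c (Suc i)" by auto
  note lt = F_less[OF xy(1)]
  from xy(1) show "(x, y) \<in> G i"
  proof (cases rule: F_cases)
    case (block j)
    then have "j = i" using lt xy assms by (intro block_unique[OF mono, of _ _ x]) auto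
    then show ?thesis using block by simp
  next
    case (node l m)
    then have "i \<le> l" "m \<le> Suc i" using xy c_less(2)[of i l] c_less(2)[of m "Suc i"] assms by auto
    then have "l = i" "m = Suc i" using node by auto
    then show ?thesis using block_whole[OF assms] node by simp
  qed
next
  fix x y assume "(x, y) \<in> G i"
  then show "(x, y) \<in> F \<inter> {(x, y). c i \<le> x \<and> y \<le> c (Suc i)}"
    using block_bounds[OF assms] assms F by blast
qed

text \<open>
  Split points exist precisely at linear nodes, and there they are the inner boundaries. So they reveal
  the kind of the node as well.
\<close>

lemma splitting_points:
  "{x. (c 0, x) \<in> F \<and> (x, c k) \<in> F} = (if \<kappa> = Linear then c ` {1..<k} else {})" (is "?L = ?R")
proof (intro equalityI subsetI)
  fix x assume "x \<in> ?L"
  then have x: "(c 0, x) \<in> F" "(x, c k) \<in> F" by auto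
  note lt = F_less[OF x(1)] F_less[OF x(2)]
  have "\<kappa> = Linear \<and> (\<exists>i. i \<le> k \<and> x = c i)"
    using x(1)
  proof (cases rule: F_cases)
    case (node i j)
    then have "\<kappa> = Linear" using lt by (cases \<kappa>) auto
    then show ?thesis using node by blast
  next
    case block1: (block i)
    then have i: "i = 0" using c_less(2)[of i 0] by simp
    show ?thesis
      using x(2)
    proof (cases rule: F_cases)
      case (node i j)
      then have "\<kappa> = Linear" using lt by (cases \<kappa>) auto
      then show ?thesis using node by (intro conjI exI[of _ i]) auto
    next
      \<comment> \<open>\<open>(c 0, x)\<close> lies in the first block and \<open>(x, c k)\<close> in the last one, so there are only
        two blocks and they meet at \<open>x\<close>\<close>
      case (block j)
      then have j: "Suc j = k" using c_less(2)[of k "Suc j"] by simp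
      then have "c 1 \<le> c j" using c_less(2)[of 1 j] k by simp
      then have "c 1 = c j" "x = c j" using block1 block i by auto
      then have "j = 1" using c_less(3)[of 1 j] j k by simp
      then show ?thesis using \<open>x = c j\<close> j arity by (cases \<kappa>) auto
    qed
  qed
  then obtain i where i: "\<kappa> = Linear" "i \<le> k" "x = c i" by blast
  moreover have "i \<noteq> 0" "i \<noteq> k" using lt i by (metis less_irrefl)+
  ultimately show "x \<in> ?R" by auto
next
  fix x assume "x \<in> ?R"
  then obtain i where i: "\<kappa> = Linear" "x = c i" "1 \<le> i" "i < k" by (auto split: if_splits)
  then have "(c 0, x) \<in> node_intervals \<kappa> c k" "(x, c k) \<in> node_intervals \<kappa> c k"
    unfolding i(1,2) node_intervals.simps mem_Collect_eq
    using i(3) less_imp_le[OF i(4)] le_refl[of k] less_le_trans[OF zero_less_one i(3)] i(4) by blast+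
  then show "x \<in> ?L" using F by blast
qed

lemma uncrossed_points:
  assumes "\<kappa> = Prime"
  shows "{x. c 0 < x \<and> x < c k \<and> (\<forall>u v. (u, v) \<in> F \<longrightarrow> u < x \<longrightarrow> x < v \<longrightarrow> (u, v) = (c 0, c k))} = c ` {1..<k}"
    (is "?L = ?R")
proof (intro equalityI subsetI)
  fix x assume x: "x \<in> ?L"
  then obtain i where i: "i < k" "c i \<le> x" "x < c (Suc i)" using ex_block[of c x k] by auto
  have "c i = x"
  proof (rule ccontr)
    assume "c i \<noteq> x"
    moreover have "(c i, c (Suc i)) \<in> F" using block_whole i F by blast
    ultimately have "(c i, c (Suc i)) = (c 0, c k)" using x i by simp
    then show False using c_less(3)[of i 0] c_less(3)[of "Suc i" k] i k by auto
  qed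
  moreover have "i \<noteq> 0" using calculation x by (metis (no_types, lifting) mem_Collect_eq less_irrefl)
  ultimately show "x \<in> ?R" using i by auto
next
  fix x assume "x \<in> ?R"
  then obtain i where i: "1 \<le> i" "i < k" "x = c i" by auto
  have "(u, v) = (c 0, c k)" if uv: "(u, v) \<in> F" "u < x" "x < v" for u v
    using uv(1)
  proof (cases rule: F_cases)
    case (block j)
    then have "c j < c i" "c i < c (Suc j)" using uv i by auto
    then show ?thesis using c_less(1)[of j i] c_less(1)[of i "Suc j"] block i by auto
  next
    case node
    then show ?thesis using assms by simp
  qed
  then show "x \<in> ?L" using i c_less(1)[of 0 i] c_less(1)[of i k] by auto
qed

lemma cuts_image: "c ` {..k} = insert (c 0) (insert (c k) (c ` {1..<k}))"
proof -
  have "{..k} = insert 0 (insert k {1..<k})" by auto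
  then show ?thesis by simp
qed

end

lemma block_family_unique:
  assumes "block_family \<kappa> k c G F" "block_family \<kappa>' k' c' G' F" "c 0 = c' 0" "c k = c' k'"
  shows "\<kappa> = \<kappa>'" "k = k'" "\<And>i. i \<le> k \<Longrightarrow> c i = c' i" "\<And>i. i < k \<Longrightarrow> G i = G' i"
proof -
  interpret A: block_family \<kappa> k c G F by fact
  interpret B: block_family \<kappa>' k' c' G' F by fact
  have "{1..<k} \<noteq> {}" "{1..<k'} \<noteq> {}" using A.k B.k by auto
  then show kind: "\<kappa> = \<kappa>'"
    using A.splitting_points B.splitting_points assms(3,4)
    by (cases \<kappa>; cases \<kappa>') (simp_all del: One_nat_def)
  have "c ` {1..<k} = c' ` {1..<k'}"
  proof (cases \<kappa>)
    case Linear
    then show ?thesis using A.splitting_points B.splitting_points assms(3,4) kind by simp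
  next
    case Prime
    then show ?thesis using A.uncrossed_points B.uncrossed_points assms(3,4) kind by simp
  qed
  then have "c ` {..k} = c' ` {..k'}" using A.cuts_image B.cuts_image assms(3,4) by simp
  from strict_mono_on_image_unique[OF A.mono B.mono this]
  show k: "k = k'" and c: "\<And>i. i \<le> k \<Longrightarrow> c i = c' i" by auto
  show "G i = G' i" if "i < k" for i
    using A.restrict_block[OF that] B.restrict_block[of i] c[of i] c[of "Suc i"] k that by simp
qed

lemma block_family_Node:
  assumes "valid (Node \<kappa> ts)"
  shows "block_family \<kappa> (length ts) (cut a ts) (\<lambda>i. tree_intervals (ts ! i) (cut a ts i)) (tree_intervals (Node \<kappa> ts) a)"
proof
  note v = valid_NodeD[OF assms]
  show "strict_mono_on {..length ts} (cut a ts)" by (rule strict_mono_cut[OF v(1)])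
  show "min_arity \<kappa> \<le> length ts" by fact
  show "tree_intervals (Node \<kappa> ts) a =
      (\<Union>i<length ts. tree_intervals (ts ! i) (cut a ts i)) \<union> node_intervals \<kappa> (cut a ts) (length ts)"
    by (rule tree_intervals_Node)
  fix i assume i: "i < length ts"
  show "(cut a ts i, cut a ts (Suc i)) \<in> tree_intervals (ts ! i) (cut a ts i)"
    using whole_in_tree_intervals[of "ts ! i"] v(1) i by (simp add: cut_Suc)
  show "cut a ts i \<le> x \<and> x < y \<and> y \<le> cut a ts (Suc i)"
    if "(x, y) \<in> tree_intervals (ts ! i) (cut a ts i)" for x y
    using tree_intervals_bounds[OF _ that] v(1) i by (simp add: cut_Suc)
qed

theorem tree_intervals_inject:
  assumes "valid t" "valid t'" "tree_intervals t a = tree_intervals t' a"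
  shows "t = t'"
  using assms
proof (induction t arbitrary: t' a)
  case Leaf
  have "leaves t' = 1" using leaves_eq_if_tree_intervals_eq[OF Leaf] by simp
  then show ?case using leaves_Node Leaf.prems(2) by (cases t') force+
next
  case (Node \<kappa> ts)
  have leaves: "leaves (Node \<kappa> ts) = leaves t'"
    by (rule leaves_eq_if_tree_intervals_eq[OF Node.prems])
  show ?case
  proof (cases t')
    case Leaf
    then show ?thesis using leaves leaves_Node[OF Node.prems(1)] by simp
  next
    case t': (Node \<kappa>' ts')
    note v = Node.prems(1) Node.prems(2)[unfolded t']
    have "cut a ts (length ts) = cut a ts' (length ts')"
      using leaves t' cut_length[of a ts \<kappa>] cut_length[of a ts' \<kappa>'] by simp
    note unique = block_family_unique[OF block_family_Node[OF v(1), of a]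
      block_family_Node[OF v(2), of a, folded t' Node.prems(3)] _ this]
    have len: "length ts = length ts'" using unique(2) by simp
    have "ts ! i = ts' ! i" if i: "i < length ts" for i
    proof (rule Node.IH)
      show "ts ! i \<in> set ts" "valid (ts ! i)" "valid (ts' ! i)"
        using i len valid_NodeD(1)[OF v(1)] valid_NodeD(1)[OF v(2)] by auto
      have "cut a ts' i = cut a ts i" using unique(3)[of i] i by simp
      then show "tree_intervals (ts ! i) (cut a ts i) = tree_intervals (ts' ! i) (cut a ts i)"
        using unique(4)[of i] i by simp
    qed
    then have "ts = ts'" using len by (rule nth_equalityI[rotated])
    then show ?thesis using t' unique(1) by simp
  qed
qed

section \<open>Intervals of a linear order\<close>

text \<open>
  Here \<open>\<tau>\<close> serves only to compare elements of \<open>S\<close>: the set \<open>A\<close> is convex for the linear order that \<open>\<tau>\<close>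
  induces on \<open>S\<close>.
\<close>

definition order_convex :: "(nat \<Rightarrow> nat) \<Rightarrow> nat set \<Rightarrow> nat set \<Rightarrow> bool" where
  "order_convex \<tau> S A \<longleftrightarrow> A \<subseteq> S \<and> (\<forall>z \<in> S. \<forall>u \<in> A. \<forall>v \<in> A. \<tau> u < \<tau> z \<longrightarrow> \<tau> z < \<tau> v \<longrightarrow> z \<in> A)"

lemma order_convexD:
  "order_convex \<tau> S A \<Longrightarrow> z \<in> S \<Longrightarrow> u \<in> A \<Longrightarrow> v \<in> A \<Longrightarrow> \<tau> u < \<tau> z \<Longrightarrow> \<tau> z < \<tau> v \<Longrightarrow> z \<in> A"
  by (auto simp: order_convex_def)

lemma order_convex_Int: "order_convex \<tau> S A \<Longrightarrow> order_convex \<tau> S B \<Longrightarrow> order_convex \<tau> S (A \<inter> B)"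
  by (auto simp: order_convex_def)

lemma order_convex_Un:
  assumes inj: "inj_on \<tau> S" and A: "order_convex \<tau> S A" and B: "order_convex \<tau> S B" and "A \<inter> B \<noteq> {}"
  shows "order_convex \<tau> S (A \<union> B)"
proof -
  obtain w where w: "w \<in> A" "w \<in> B" using assms(4) by blast
  have wS: "w \<in> S" using A w by (auto simp: order_convex_def)
  have "z \<in> A \<union> B" if z: "z \<in> S" "u \<in> A \<union> B" "v \<in> A \<union> B" "\<tau> u < \<tau> z" "\<tau> z < \<tau> v" for z u v
  proof -
    consider "\<tau> z < \<tau> w" | "z = w" | "\<tau> w < \<tau> z"
      using inj z(1) wS by (meson inj_onD nat_neq_iff)
    then show ?thesis
      by cases (use z w order_convexD[OF A z(1)] order_convexD[OF B z(1)] in blast)+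
  qed
  then show ?thesis using A B unfolding order_convex_def by blast
qed

text \<open>
  An element \<open>w\<close> of \<open>B\<close> outside \<open>A\<close> lies beyond one end of the convex set \<open>A\<close>. If some \<open>z\<close> in \<open>B\<close> were
  between two elements of \<open>A - B\<close>, then one of these two would be between \<open>w\<close> and \<open>z\<close>, hence in \<open>B\<close>.
\<close>

lemma order_convex_Diff:
  assumes inj: "inj_on \<tau> S" and A: "order_convex \<tau> S A" and B: "order_convex \<tau> S B" and "\<not> B \<subseteq> A"
  shows "order_convex \<tau> S (A - B)"
proof -
  obtain w where w: "w \<in> B" "w \<notin> A" using assms(4) by blast
  have sub: "A \<subseteq> S" "B \<subseteq> S" using A B by (auto simp: order_convex_def)
  have "z \<in> A - B" if z: "z \<in> S" "u \<in> A - B" "v \<in> A - B" "\<tau> u < \<tau> z" "\<tau> z < \<tau> v" for z u v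
  proof -
    have "z \<in> A" using order_convexD[OF A z(1)] z by blast
    moreover have "z \<notin> B"
    proof
      assume "z \<in> B"
      have neq: "\<tau> w \<noteq> \<tau> u" "\<tau> w \<noteq> \<tau> v"
        using inj_onD[OF inj] w z sub by blast+
      have "\<not> \<tau> w < \<tau> u" using order_convexD[OF B, of u w z] w z sub \<open>z \<in> B\<close> by blast
      moreover have "\<not> \<tau> v < \<tau> w" using order_convexD[OF B, of v z w] w z sub \<open>z \<in> B\<close> by blast
      moreover have "\<not> (\<tau> u < \<tau> w \<and> \<tau> w < \<tau> v)" using order_convexD[OF A, of w u v] w z sub by blast
      ultimately show False using neq by linarith
    qed
    ultimately show ?thesis by blast
  qed
  then show ?thesis using sub unfolding order_convex_def by blast
qed

lemma order_convex_disjoint_less: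
  assumes inj: "inj_on \<tau> S" and A: "order_convex \<tau> S A" and B: "order_convex \<tau> S B" and "A \<inter> B = {}"
    and in_AB: "p \<in> A" "p' \<in> A" "q \<in> B" "q' \<in> B" and "\<tau> p < \<tau> q"
  shows "\<tau> p' < \<tau> q'"
proof -
  have sub: "A \<subseteq> S" "B \<subseteq> S" using A B by (auto simp: order_convex_def)
  have neq: "\<tau> p' \<noteq> \<tau> q'" "\<tau> p' \<noteq> \<tau> q"
    using inj_onD[OF inj] in_AB sub assms(4) by blast+
  have "\<not> \<tau> q < \<tau> p'" using order_convexD[OF A, of q p p'] in_AB sub assms(4,9) by blast
  moreover have "\<not> (\<tau> q' < \<tau> p' \<and> \<tau> p' < \<tau> q)" using order_convexD[OF B, of p' q' q] in_AB sub assms(4) by blast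
  ultimately show ?thesis using neq by linarith
qed

text \<open>
  Disjoint convex sets are linearly ordered as wholes. If neither union were convex, then \<open>C\<close> would lie
  between \<open>A\<close> and \<open>B\<close>, and \<open>A\<close> between \<open>B\<close> and \<open>C\<close>.
\<close>

lemma order_convex_triple:
  assumes inj: "inj_on \<tau> S" and A: "order_convex \<tau> S A" and B: "order_convex \<tau> S B" and C: "order_convex \<tau> S C"
    and disj: "A \<inter> B = {}" "A \<inter> C = {}" "B \<inter> C = {}" and un: "order_convex \<tau> S (A \<union> B \<union> C)"
  shows "order_convex \<tau> S (A \<union> B) \<or> order_convex \<tau> S (B \<union> C)"
proof (rule ccontr)
  assume neg: "\<not> ?thesis"
  have sub: "A \<subseteq> S" "B \<subseteq> S" "C \<subseteq> S" using A B C by (auto simp: order_convex_def)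
  obtain z u v where z: "z \<in> S" "u \<in> A \<union> B" "v \<in> A \<union> B" "\<tau> u < \<tau> z" "\<tau> z < \<tau> v" "z \<notin> A \<union> B"
    using neg sub unfolding order_convex_def by blast
  have zC: "z \<in> C" using order_convexD[OF un, of z u v] z by blast
  obtain z' u' v' where z': "z' \<in> S" "u' \<in> B \<union> C" "v' \<in> B \<union> C" "\<tau> u' < \<tau> z'" "\<tau> z' < \<tau> v'" "z' \<notin> B \<union> C"
    using neg sub unfolding order_convex_def by blast
  have zA: "z' \<in> A" using order_convexD[OF un, of z' u' v'] z' by blast
  note less = order_convex_disjoint_less[OF inj]
  have "\<not> (u \<in> A \<and> v \<in> A)" "\<not> (u \<in> B \<and> v \<in> B)"
    using order_convexD[OF A, of z u v] order_convexD[OF B, of z u v] z by blast+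
  moreover have "\<tau> u < \<tau> v" using z by simp
  ultimately consider "u \<in> A" "v \<in> B" "\<tau> u < \<tau> v" | "u \<in> B" "v \<in> A" "\<tau> u < \<tau> v"
    using z(2,3) by blast
  then show False
  proof cases
    case 1
    \<comment> \<open>\<open>A\<close> precedes both \<open>C\<close> and \<open>B\<close>\<close>
    have "\<tau> z' < \<tau> u'"
    proof (cases "u' \<in> B")
      case True
      show ?thesis by (rule less[OF A B disj(1) 1(1) zA 1(2) True 1(3)])
    next
      case False
      then have "u' \<in> C" using z'(2) by blast
      then show ?thesis by (rule less[OF A C disj(2) 1(1) zA zC _ z(4)])
    qed
    then show False using z' by simp
  next
    case 2
    \<comment> \<open>\<open>A\<close> comes after both \<open>C\<close> and \<open>B\<close>\<close>
    have disj': "B \<inter> A = {}" "C \<inter> A = {}" using disj by blast+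
    have "\<tau> v' < \<tau> z'"
    proof (cases "v' \<in> B")
      case True
      show ?thesis by (rule less[OF B A disj'(1) 2(1) True 2(2) zA 2(3)])
    next
      case False
      then have "v' \<in> C" using z'(3) by blast
      then show ?thesis by (rule less[OF C A disj'(2) zC _ 2(2) zA z(5)])
    qed
    then show False using z' by simp
  qed
qed

definition value_intervals :: "(nat \<Rightarrow> nat) \<Rightarrow> nat \<Rightarrow> nat \<Rightarrow> (nat \<times> nat) set" where
  "value_intervals \<tau> a b = {(x, y). x < y \<and> order_convex \<tau> {a..<b} {x..<y}}"

lemma value_intervals_bounds:
  assumes "(x, y) \<in> value_intervals \<tau> a b"
  shows "a \<le> x" "x < y" "y \<le> b"
  using assms by (auto simp: value_intervals_def order_convex_def)

lemma value_intervals_convex: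
  assumes "(x, y) \<in> value_intervals \<tau> a b" "a \<le> z" "z < b" "x \<le> u" "u < y" "x \<le> v" "v < y"
    "\<tau> u < \<tau> z" "\<tau> z < \<tau> v"
  shows "x \<le> z \<and> z < y"
proof -
  have "order_convex \<tau> {a..<b} {x..<y}" using assms(1) by (simp add: value_intervals_def)
  from order_convexD[OF this, of z u v] assms show ?thesis by simp
qed

lemma value_intervalsI:
  assumes "a \<le> x" "x < y" "y \<le> b"
    and "\<And>z u v. a \<le> z \<Longrightarrow> z < b \<Longrightarrow> x \<le> u \<Longrightarrow> u < y \<Longrightarrow> x \<le> v \<Longrightarrow> v < y \<Longrightarrow>
      \<tau> u < \<tau> z \<Longrightarrow> \<tau> z < \<tau> v \<Longrightarrow> x \<le> z \<and> z < y"
  shows "(x, y) \<in> value_intervals \<tau> a b"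
  unfolding value_intervals_def order_convex_def mem_Collect_eq case_prod_conv
  using assms(1-3) by (intro conjI ballI impI) (simp_all, use assms(4) in blast)

lemma value_intervals_system:
  assumes inj: "inj_on \<tau> {a..<b}" and "a < b"
  shows "interval_system (value_intervals \<tau> a b) a b"
proof
  let ?S = "{a..<b}"
  show "a \<le> x \<and> x < y \<and> y \<le> b" if "(x, y) \<in> value_intervals \<tau> a b" for x y
    using value_intervals_bounds[OF that] by simp
  show "(a, b) \<in> value_intervals \<tau> a b" using assms(2) by (intro value_intervalsI) auto
  show "(x, Suc x) \<in> value_intervals \<tau> a b" if "a \<le> x" "x < b" for x
    using that
  proof (intro value_intervalsI)
    fix z u v assume "x \<le> u" "u < Suc x" "x \<le> v" "v < Suc x" "\<tau> u < \<tau> z" "\<tau> z < \<tau> v"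
    then have "u = x" "v = x" by simp_all
    with \<open>\<tau> u < \<tau> z\<close> \<open>\<tau> z < \<tau> v\<close> show "x \<le> z \<and> z < Suc x" by simp
  qed auto
  show "(x, y') \<in> value_intervals \<tau> a b \<and> (x', y) \<in> value_intervals \<tau> a b \<and>
      (x, x') \<in> value_intervals \<tau> a b \<and> (y, y') \<in> value_intervals \<tau> a b"
    if "(x, y) \<in> value_intervals \<tau> a b" "(x', y') \<in> value_intervals \<tau> a b" "x < x'" "x' < y" "y < y'"
    for x y x' y'
  proof -
    have A: "order_convex \<tau> ?S {x..<y}" and B: "order_convex \<tau> ?S {x'..<y'}"
      using that by (auto simp: value_intervals_def)
    have eqs: "{x..<y} \<union> {x'..<y'} = {x..<y'}" "{x..<y} \<inter> {x'..<y'} = {x'..<y}"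
      "{x..<y} - {x'..<y'} = {x..<x'}" "{x'..<y'} - {x..<y} = {y..<y'}"
      using that(3-5) by auto
    have "{x'..<y} \<noteq> {}" using that(4) by simp
    then have "order_convex \<tau> ?S {x..<y'}"
      using order_convex_Un[OF inj A B] unfolding eqs by blast
    moreover have "order_convex \<tau> ?S {x'..<y}"
      using order_convex_Int[OF A B] unfolding eqs .
    moreover have "x \<notin> {x'..<y'}" "y \<notin> {x..<y}" "x \<in> {x..<y}" "y \<in> {x'..<y'}"
      using that(3-5) by auto
    then have "\<not> {x..<y} \<subseteq> {x'..<y'}" "\<not> {x'..<y'} \<subseteq> {x..<y}" by blast+
    then have "order_convex \<tau> ?S {x..<x'}" "order_convex \<tau> ?S {y..<y'}"
      using order_convex_Diff[OF inj A B] order_convex_Diff[OF inj B A] unfolding eqs by blast+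
    ultimately have "order_convex \<tau> ?S {x..<y'}" "order_convex \<tau> ?S {x'..<y}"
      "order_convex \<tau> ?S {x..<x'}" "order_convex \<tau> ?S {y..<y'}" by blast+
    then show ?thesis using that(3-5) by (simp add: value_intervals_def)
  qed
  show "(x, z) \<in> value_intervals \<tau> a b \<or> (y, w) \<in> value_intervals \<tau> a b"
    if "(x, y) \<in> value_intervals \<tau> a b" "(y, z) \<in> value_intervals \<tau> a b" "(z, w) \<in> value_intervals \<tau> a b"
      "(x, w) \<in> value_intervals \<tau> a b" for x y z w
  proof -
    have lt: "x < y" "y < z" "z < w" using that by (auto simp: value_intervals_def)
    have eqs: "{x..<y} \<union> {y..<z} = {x..<z}" "{y..<z} \<union> {z..<w} = {y..<w}" "{x..<z} \<union> {z..<w} = {x..<w}"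
      using lt by auto
    have disj: "{x..<y} \<inter> {y..<z} = {}" "{x..<y} \<inter> {z..<w} = {}" "{y..<z} \<inter> {z..<w} = {}"
      using lt by auto
    have conv: "order_convex \<tau> ?S {x..<y}" "order_convex \<tau> ?S {y..<z}" "order_convex \<tau> ?S {z..<w}"
      "order_convex \<tau> ?S {x..<w}"
      using that by (simp_all add: value_intervals_def)
    from order_convex_triple[OF inj conv(1-3) disj, unfolded eqs, OF conv(4)] lt
    show ?thesis by (simp add: value_intervals_def)
  qed
qed

lemma order_convex_reverse:
  assumes "\<And>x y. x \<in> S \<Longrightarrow> y \<in> S \<Longrightarrow> \<tau>' x < \<tau>' y \<longleftrightarrow> \<tau> y < \<tau> x" and "order_convex \<tau> S A"
  shows "order_convex \<tau>' S A"
proof -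
  have A: "A \<subseteq> S" using assms(2) by (simp add: order_convex_def)
  have "z \<in> A" if "z \<in> S" "u \<in> A" "v \<in> A" "\<tau>' u < \<tau>' z" "\<tau>' z < \<tau>' v" for z u v
  proof (rule order_convexD[OF assms(2) that(1,3,2)])
    have "u \<in> S" "v \<in> S" using that A by blast+
    then show "\<tau> v < \<tau> z" "\<tau> z < \<tau> u" using assms(1) that by simp_all
  qed
  then show ?thesis using A unfolding order_convex_def by blast
qed

lemma value_intervals_reverse:
  assumes "\<And>x. x \<in> {a..<b} \<Longrightarrow> \<tau> x \<le> M"
  shows "value_intervals (\<lambda>x. M - \<tau> x) a b = value_intervals \<tau> a b"
proof -
  have less: "M - \<tau> x < M - \<tau> y \<longleftrightarrow> \<tau> y < \<tau> x" if "x \<in> {a..<b}" "y \<in> {a..<b}" for x y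
    using assms[OF that(1)] assms[OF that(2)] by arith
  have "order_convex (\<lambda>x. M - \<tau> x) {a..<b} A \<longleftrightarrow> order_convex \<tau> {a..<b} A" for A
    using order_convex_reverse[of "{a..<b}" "\<lambda>x. M - \<tau> x" \<tau> A]
      order_convex_reverse[of "{a..<b}" \<tau> "\<lambda>x. M - \<tau> x" A] less by blast
  then show ?thesis unfolding value_intervals_def by simp
qed

text \<open>
  For even \<open>k\<close>, the values \<open>0, \<dots>, k - 1\<close> are arranged as \<open>1 3 5 \<dots> 0 2 4 \<dots>\<close>, odd values first. For odd
  \<open>k\<close> this would end in the largest value, whose removal leaves an interval; so this value is moved
  to the place right after \<open>0\<close>.
\<close>

definition simple_order :: "nat \<Rightarrow> nat \<Rightarrow> nat" where
  "simple_order k v = (if odd v then v else if v = 0 then 2 * k else if v = k - 1 then 2 * k + 1 else 2 * k + 2 * v)"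

lemma inj_simple_order: "inj_on (simple_order k) {0..<k}"
proof (rule inj_onI)
  fix u v assume "u \<in> {0..<k}" "v \<in> {0..<k}" "simple_order k u = simple_order k v"
  then have "u < k" "v < k" "simple_order k u = simple_order k v" by simp_all
  then show "u = v" 
    by (cases "odd u"; cases "odd v"; cases "u = 0"; cases "v = 0"; cases "u = k - 1"; cases "v = k - 1";
        simp add: simple_order_def; presburger)
qed

text \<open>
  An interval with two elements contains an odd and an even value, hence \<open>0\<close>, which is placed between the
  odd values and all other even ones. Then it contains \<open>1\<close> as well, and with \<open>1\<close> and \<open>0\<close> all odd values in
  between, so that at most the value \<open>k - 1\<close> is missing. If \<open>k\<close> is odd, that value lies between \<open>0\<close> and \<open>2\<close>.
\<close>

lemma simple_order_simple:
  assumes "(x, y) \<in> value_intervals (simple_order k) 0 k" "k \<ge> 4"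
  shows "y = Suc x \<or> (x = 0 \<and> y = k)"
proof (rule disjCI)
  let ?f = "simple_order k"
  assume "\<not> (x = 0 \<and> y = k)"
  show "y = Suc x"
  proof (rule ccontr)
    assume "y \<noteq> Suc x"
    then have xy: "Suc x < y" "y \<le> k" using value_intervals_bounds[OF assms(1)] by simp_all
    have conv: "x \<le> z \<and> z < y"
      if "z < k" "x \<le> u" "u < y" "x \<le> v" "v < y" "?f u < ?f z" "?f z < ?f v" for z u v
      by (rule value_intervals_convex[OF assms(1), of z u v]) (use that in simp_all)
    obtain p q where pq: "x \<le> p" "p < y" "odd p" "x \<le> q" "q < y" "even q"
      using xy by (cases "even x") (auto intro: that[of x "Suc x"] that[of "Suc x" x])
    have "x = 0"
    proof (cases "q = 0")
      case False
      have "?f p < ?f 0" "?f 0 < ?f q" using pq xy False by (auto simp: simple_order_def)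
      then show ?thesis using conv[of 0 p q] pq xy by auto
    qed (use pq in simp)
    moreover have "y = k"
    proof -
      \<comment> \<open>the largest odd value\<close>
      define m where "m = (if even k then k - 1 else k - 2)"
      have m: "odd m" "m < k" "m \<noteq> 0" "k \<le> m + 2" using assms(2) by (auto simp: m_def)
      have "m < y"
      proof (cases "m = 1")
        case False
        then have "?f 1 < ?f m" "?f m < ?f 0" using m by (auto simp: simple_order_def)
        then show ?thesis using conv[of m 1 0] xy m \<open>x = 0\<close> by auto
      qed (use xy \<open>x = 0\<close> in simp)
      show ?thesis
      proof (cases "even k")
        case True
        then show ?thesis using \<open>m < y\<close> xy by (simp add: m_def)
      next
        case False
        then have k: "k \<ge> 5" using assms(2) by (cases "k = 4") auto
        then have "2 < y" using \<open>m < y\<close> False by (simp add: m_def)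
        moreover have "?f 0 < ?f (k - 1)" "?f (k - 1) < ?f 2"
          using k False by (auto simp: simple_order_def)
        ultimately have "k - 1 < y" using conv[of "k - 1" 0 2] \<open>x = 0\<close> xy k by simp
        then show ?thesis using xy by simp
      qed
    qed
    ultimately show False using \<open>\<not> (x = 0 \<and> y = k)\<close> by simp
  qed
qed

section \<open>Every tree comes from a linear order\<close>

text \<open>
  The order \<open>\<tau>\<close> arranges the \<open>k\<close> blocks as prescribed by \<open>\<pi>\<close>, and the \<open>i\<close>-th block internally as
  prescribed by \<open>T i\<close>. In terms of permutations, it is the inflation of \<open>\<pi>\<close> by the \<open>T i\<close>.
\<close>

locale inflation =
  fixes k :: nat and c :: "nat \<Rightarrow> nat" and \<pi> :: "nat \<Rightarrow> nat" and T :: "nat \<Rightarrow> nat \<Rightarrow> nat" and \<tau> :: "nat \<Rightarrow> nat"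
  assumes mono: "strict_mono_on {..k} c"
    and inj_pattern: "inj_on \<pi> {0..<k}"
    and inj_block: "\<And>i. i < k \<Longrightarrow> inj_on (T i) {c i..<c (Suc i)}"
    and same_block: "\<And>i x y. i < k \<Longrightarrow> x \<in> {c i..<c (Suc i)} \<Longrightarrow> y \<in> {c i..<c (Suc i)} \<Longrightarrow> \<tau> x < \<tau> y \<longleftrightarrow> T i x < T i y"
    and other_block: "\<And>i j x y. i < k \<Longrightarrow> j < k \<Longrightarrow> i \<noteq> j \<Longrightarrow> x \<in> {c i..<c (Suc i)} \<Longrightarrow> y \<in> {c j..<c (Suc j)} \<Longrightarrow> \<tau> x < \<tau> y \<longleftrightarrow> \<pi> i < \<pi> j"
begin

lemmas c_less = strict_mono_on_less_iff[OF mono]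

lemma obtain_block:
  assumes "c 0 \<le> x" "x < c k"
  obtains i where "i < k" "x \<in> {c i..<c (Suc i)}"
  using ex_block[OF assms] by auto

lemma block_le: "i < k \<Longrightarrow> c 0 \<le> c i \<and> c (Suc i) \<le> c k \<and> c i < c (Suc i)"
  using c_less(2)[of 0 i] c_less(2)[of "Suc i" k] c_less(1)[of i "Suc i"] by simp

lemma inj: "inj_on \<tau> {c 0..<c k}"
proof (rule inj_onI)
  fix x y assume xy: "x \<in> {c 0..<c k}" "y \<in> {c 0..<c k}" "\<tau> x = \<tau> y"
  obtain i where i: "i < k" "x \<in> {c i..<c (Suc i)}" using obtain_block[of x] xy by auto
  obtain j where j: "j < k" "y \<in> {c j..<c (Suc j)}" using obtain_block[of y] xy by auto
  show "x = y"
  proof (cases "i = j")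
    case True
    then have "T i x = T i y"
      using same_block[OF i(1,2), of y] same_block[OF i(1) _ i(2), of y] j xy(3) by simp
    then show ?thesis using inj_onD[OF inj_block[OF i(1)]] i j True by blast
  next
    case False
    then have "\<pi> i = \<pi> j"
      using other_block[OF i(1) j(1) False i(2) j(2)] other_block[OF j(1) i(1) _ j(2) i(2)] xy(3) by simp
    then show ?thesis using inj_onD[OF inj_pattern] i j False by simp
  qed
qed

lemma interval_in_block:
  assumes i: "i < k" and xy: "c i \<le> x" "y \<le> c (Suc i)"
  shows "(x, y) \<in> value_intervals \<tau> (c 0) (c k) \<longleftrightarrow> (x, y) \<in> value_intervals (T i) (c i) (c (Suc i))"
proof
  assume V: "(x, y) \<in> value_intervals \<tau> (c 0) (c k)"
  note b = value_intervals_bounds[OF V]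
  show "(x, y) \<in> value_intervals (T i) (c i) (c (Suc i))"
  proof (rule value_intervalsI)
    fix z u v assume *: "c i \<le> z" "z < c (Suc i)" "x \<le> u" "u < y" "x \<le> v" "v < y" "T i u < T i z" "T i z < T i v"
    then have "\<tau> u < \<tau> z" "\<tau> z < \<tau> v" using same_block[OF i, of u z] same_block[OF i, of z v] xy by simp_all
    then show "x \<le> z \<and> z < y" using value_intervals_convex[OF V, of z u v] * block_le[OF i] by simp
  qed (use b xy in simp_all)
next
  assume V: "(x, y) \<in> value_intervals (T i) (c i) (c (Suc i))"
  note b = value_intervals_bounds[OF V]
  show "(x, y) \<in> value_intervals \<tau> (c 0) (c k)"
  proof (rule value_intervalsI)
    fix z u v assume *: "c 0 \<le> z" "z < c k" "x \<le> u" "u < y" "x \<le> v" "v < y" "\<tau> u < \<tau> z" "\<tau> z < \<tau> v"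
    have uv: "u \<in> {c i..<c (Suc i)}" "v \<in> {c i..<c (Suc i)}" using * xy by auto
    obtain j where j: "j < k" "z \<in> {c j..<c (Suc j)}" using obtain_block[of z] * by auto
    have "j = i"
    proof (rule ccontr)
      assume ne: "j \<noteq> i"
      then have "\<pi> i < \<pi> j" using other_block[OF i j(1) _ uv(1) j(2)] * by simp
      moreover have "\<pi> j < \<pi> i" using other_block[OF j(1) i ne j(2) uv(2)] * by simp
      ultimately show False by simp
    qed
    then have "T i u < T i z" "T i z < T i v"
      using same_block[OF i uv(1), of z] same_block[OF i _ uv(2), of z] j * by simp_all
    then show "x \<le> z \<and> z < y" using value_intervals_convex[OF V, of z u v] * j \<open>j = i\<close> by simp
  qed (use b xy block_le[OF i] in simp_all)
qed

lemma interval_of_blocks: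
  assumes "(i, j) \<in> value_intervals \<pi> 0 k"
  shows "(c i, c j) \<in> value_intervals \<tau> (c 0) (c k)"
proof (rule value_intervalsI)
  note b = value_intervals_bounds[OF assms]
  show "c 0 \<le> c i" "c i < c j" "c j \<le> c k"
    using c_less(2)[of 0 i] c_less(1)[of i j] c_less(2)[of j k] b by auto
  fix z u v assume *: "c 0 \<le> z" "z < c k" "c i \<le> u" "u < c j" "c i \<le> v" "v < c j" "\<tau> u < \<tau> z" "\<tau> z < \<tau> v"
  have block_in: "i \<le> m \<and> m < j" if "c i \<le> w" "w < c j" "m < k" "w \<in> {c m..<c (Suc m)}" for w m
  proof -
    have "c i < c (Suc m)" "c m < c j" using that by auto
    then show ?thesis using c_less(1)[of i "Suc m"] c_less(1)[of m j] b that by auto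
  qed
  obtain l where l: "l < k" "z \<in> {c l..<c (Suc l)}" using obtain_block[of z] * by auto
  obtain p where p: "p < k" "u \<in> {c p..<c (Suc p)}" using obtain_block[of u] * \<open>c 0 \<le> c i\<close> \<open>c j \<le> c k\<close> by auto
  obtain q where q: "q < k" "v \<in> {c q..<c (Suc q)}" using obtain_block[of v] * \<open>c 0 \<le> c i\<close> \<open>c j \<le> c k\<close> by auto
  have pq: "i \<le> p \<and> p < j" "i \<le> q \<and> q < j" using block_in[of u p] block_in[of v q] p q * by simp_all
  have "i \<le> l \<and> l < j"
  proof (cases "l = p \<or> l = q")
    case False
    then have "\<pi> p < \<pi> l" "\<pi> l < \<pi> q"
      using other_block[OF p(1) l(1) _ p(2) l(2)] other_block[OF l(1) q(1) _ l(2) q(2)] * by auto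
    then show ?thesis using value_intervals_convex[OF assms, of l p q] l pq by simp
  qed (use pq in auto)
  then have "c i \<le> c l" "c (Suc l) \<le> c j" using c_less(2)[of i l] c_less(2)[of "Suc l" j] b by auto
  then show "c i \<le> z \<and> z < c j" using l by simp
qed

text \<open>An interval meeting the blocks \<open>i..j\<close> contains each block that \<open>\<pi>\<close> places between
  two of them, because it has an element in either of these two.\<close>

lemma between_blocks:
  assumes V: "(x, y) \<in> value_intervals \<tau> (c 0) (c k)"
    and ij: "i < j" "j < k" "c i \<le> x" "x < c (Suc i)" "c j < y" "y \<le> c (Suc j)"
    and pq: "i \<le> p" "p \<le> j" "i \<le> q" "q \<le> j" and l: "l < k" "\<pi> p < \<pi> l" "\<pi> l < \<pi> q"
    and z: "c l \<le> z" "z < c (Suc l)"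
  shows "x \<le> z \<and> z < y"
proof -
  have meet: "\<exists>u. x \<le> u \<and> u < y \<and> u \<in> {c m..<c (Suc m)}" if "i \<le> m" "m \<le> j" for m
  proof (cases "m = i")
    case True
    then show ?thesis using ij value_intervals_bounds[OF V] by (intro exI[of _ x]) auto
  next
    case False
    then have "c (Suc i) \<le> c m" "c m \<le> c j" "c m < c (Suc m)"
      using c_less(2)[of "Suc i" m] c_less(2)[of m j] c_less(1)[of m "Suc m"] that ij by auto
    then show ?thesis using ij by (intro exI[of _ "c m"]) auto
  qed
  obtain u where u: "x \<le> u" "u < y" "u \<in> {c p..<c (Suc p)}" using meet[OF pq(1,2)] by blast
  obtain v where v: "x \<le> v" "v < y" "v \<in> {c q..<c (Suc q)}" using meet[OF pq(3,4)] by blast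
  have z': "z \<in> {c l..<c (Suc l)}" using z by simp
  have pqk: "p < k" "q < k" using pq ij by auto
  have "p \<noteq> l" "l \<noteq> q" using l by auto
  then have "\<tau> u < \<tau> z" "\<tau> z < \<tau> v"
    using other_block[OF pqk(1) l(1) _ u(3) z'] other_block[OF l(1) pqk(2) _ z' v(3)] l by simp_all
  then show ?thesis
    using value_intervals_convex[OF V, of z u v] u v z block_le[OF l(1)] by simp
qed

lemma pattern_interval:
  assumes V: "(x, y) \<in> value_intervals \<tau> (c 0) (c k)"
    and ij: "i < j" "j < k" "c i \<le> x" "x < c (Suc i)" "c j < y" "y \<le> c (Suc j)"
  shows "(i, Suc j) \<in> value_intervals \<pi> 0 k"
proof (rule value_intervalsI)
  fix l p q assume *: "l < k" "i \<le> p" "p < Suc j" "i \<le> q" "q < Suc j" "\<pi> p < \<pi> l" "\<pi> l < \<pi> q"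
  have "c l < c (Suc l)" using block_le[OF *(1)] by simp
  then have "x \<le> c l \<and> c l < y" using between_blocks[OF V ij, of p q l "c l"] * by simp
  then have "c i \<le> c l" "c l < c (Suc j)" using ij by auto
  then show "i \<le> l \<and> l < Suc j" using c_less(2)[of i l] c_less(1)[of l "Suc j"] * ij by auto
qed (use ij in auto)

lemma crossing_cases:
  assumes V: "(x, y) \<in> value_intervals \<tau> (c 0) (c k)"
  obtains (block) i where "i < k" "c i \<le> x" "y \<le> c (Suc i)"
  | (crossing) i j where "i < j" "j < k" "c i \<le> x" "x < c (Suc i)" "c j < y" "y \<le> c (Suc j)"
proof -
  note b = value_intervals_bounds[OF V]
  obtain i where i: "i < k" "x \<in> {c i..<c (Suc i)}" using obtain_block[of x] b by auto
  have "c 0 \<le> y - 1" "y - 1 < c k" using b by linarith+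
  then obtain j where j: "j < k" "y - 1 \<in> {c j..<c (Suc j)}" by (rule obtain_block)
  have y: "c j < y" "y \<le> c (Suc j)" using j b by auto
  have "i \<le> j"
  proof (rule ccontr)
    assume "\<not> i \<le> j"
    then have "c (Suc j) \<le> c i" using c_less(2)[of "Suc j" i] i by simp
    then show False using y i b by simp
  qed
  then consider "i = j" | "i < j" by linarith
  then show ?thesis
  proof cases
    case 1
    then show ?thesis using block i y by simp
  next
    case 2
    then show ?thesis using crossing i j y by simp
  qed
qed

text \<open>
  What remains to be checked for each kind of node are the intervals that meet two blocks.
\<close>

lemma value_intervals_decompose:
  assumes node: "\<And>i j. i < j \<Longrightarrow> j \<le> k \<Longrightarrow> (c i, c j) \<in> node_intervals \<kappa> c k \<Longrightarrow> (i, j) \<in> value_intervals \<pi> 0 k"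
    and crossing: "\<And>x y i j. (x, y) \<in> value_intervals \<tau> (c 0) (c k) \<Longrightarrow> i < j \<Longrightarrow> j < k \<Longrightarrow>
      c i \<le> x \<Longrightarrow> x < c (Suc i) \<Longrightarrow> c j < y \<Longrightarrow> y \<le> c (Suc j) \<Longrightarrow> (x, y) \<in> node_intervals \<kappa> c k"
    and "k > 0"
  shows "value_intervals \<tau> (c 0) (c k) = (\<Union>i<k. value_intervals (T i) (c i) (c (Suc i))) \<union> node_intervals \<kappa> c k"
proof (intro equalityI subrelI)
  fix x y assume V: "(x, y) \<in> value_intervals \<tau> (c 0) (c k)"
  from V show "(x, y) \<in> (\<Union>i<k. value_intervals (T i) (c i) (c (Suc i))) \<union> node_intervals \<kappa> c k"
  proof (cases rule: crossing_cases)
    case (block i)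
    then show ?thesis using interval_in_block[of i x y] V by blast
  next
    case (crossing i j)
    then show ?thesis using assms(2)[OF V] by blast
  qed
next
  fix x y assume "(x, y) \<in> (\<Union>i<k. value_intervals (T i) (c i) (c (Suc i))) \<union> node_intervals \<kappa> c k"
  then consider i where "i < k" "(x, y) \<in> value_intervals (T i) (c i) (c (Suc i))"
    | "(x, y) \<in> node_intervals \<kappa> c k" by blast
  then show "(x, y) \<in> value_intervals \<tau> (c 0) (c k)"
  proof cases
    case 1
    then show ?thesis using interval_in_block[of i x y] value_intervals_bounds[OF 1(2)] by simp
  next
    case 2
    then have "\<exists>i j. i < j \<and> j \<le> k \<and> x = c i \<and> y = c j"
      using \<open>k > 0\<close> by (cases \<kappa>) auto
    then obtain i j where "i < j" "j \<le> k" "x = c i" "y = c j" by blast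
    then show ?thesis using interval_of_blocks[OF node, of i j] 2 by simp
  qed
qed

text \<open>
  An interval meeting two blocks meets all of them, as the pattern is simple, so it could miss a part only of
  the bottom or of the top block. A block of which a part is missed is extremal for
  \<open>\<pi>\<close>, since convexity makes the interval contain all other blocks. But then the remaining blocks would form a proper interval of the pattern.
\<close>

lemma prime_value_intervals:
  assumes "k \<ge> 4" and simple: "\<And>i j. (i, j) \<in> value_intervals \<pi> 0 k \<Longrightarrow> j = Suc i \<or> (i = 0 \<and> j = k)"
  shows "value_intervals \<tau> (c 0) (c k) = (\<Union>i<k. value_intervals (T i) (c i) (c (Suc i))) \<union> node_intervals Prime c k"
proof (rule value_intervals_decompose)
  show "(i, j) \<in> value_intervals \<pi> 0 k" if "i < j" "j \<le> k" "(c i, c j) \<in> node_intervals Prime c k" for i j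
  proof -
    have "i = 0" "j = k" using that c_less(3)[of i 0] c_less(3)[of j k] by auto
    then show ?thesis using assms(1) by (intro value_intervalsI) auto
  qed
  fix x y i j
  assume V: "(x, y) \<in> value_intervals \<tau> (c 0) (c k)"
    and ij: "i < j" "j < k" "c i \<le> x" "x < c (Suc i)" "c j < y" "y \<le> c (Suc j)"
  note b = value_intervals_bounds[OF V]
  have "i = 0" "Suc j = k" using simple[OF pattern_interval[OF V ij]] ij by auto
  note between = between_blocks[OF V ij]
  have "x = c 0"
  proof (rule ccontr)
    assume "x \<noteq> c 0"
    \<comment> \<open>the bottom block is then extremal for \<open>\<pi>\<close>, so that the other blocks form an interval\<close>
    have "(1, k) \<in> value_intervals \<pi> 0 k"
    proof (rule value_intervalsI)
      fix l p q assume *: "l < k" "1 \<le> p" "p < k" "1 \<le> q" "q < k" "\<pi> p < \<pi> l" "\<pi> l < \<pi> q"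
      have "l \<noteq> 0"
      proof
        assume "l = 0"
        then have "x \<le> c 0" using between[of p q 0 "c 0"] * block_le[of 0] \<open>i = 0\<close> \<open>Suc j = k\<close> by auto
        then show False using \<open>x \<noteq> c 0\<close> b by simp
      qed
      then show "1 \<le> l \<and> l < k" using * by simp
    qed (use assms(1) in auto)
    then show False using simple[of 1 k] assms(1) by simp
  qed
  moreover have "y = c k"
  proof (rule ccontr)
    assume "y \<noteq> c k"
    \<comment> \<open>likewise for the top block\<close>
    have "(0, k - 1) \<in> value_intervals \<pi> 0 k"
    proof (rule value_intervalsI)
      fix l p q assume *: "l < k" "p < k - 1" "q < k - 1" "\<pi> p < \<pi> l" "\<pi> l < \<pi> q"
      have "l \<noteq> j"
      proof
        assume "l = j"
        then have "c k - 1 < y"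
          using between[of p q j "c k - 1"] * block_le[of j] \<open>i = 0\<close> \<open>Suc j = k\<close> by auto
        then show False using \<open>y \<noteq> c k\<close> b by simp
      qed
      then show "0 \<le> l \<and> l < k - 1" using * \<open>Suc j = k\<close> by auto
    qed (use assms(1) in auto)
    then have "k - 1 = Suc 0 \<or> k - 1 = k" using simple[of 0 "k - 1"] by simp
    then show False using assms(1) by linarith
  qed
  ultimately show "(x, y) \<in> node_intervals Prime c k" by simp
qed (use assms in simp)

text \<open>
  The blocks are in increasing order, so an interval meeting several blocks contains an upper part of the
  lowest one, including its top value. The bottom value of this block comes after its top value (this is
  \<open>top_first\<close>) and before all higher blocks, so it belongs to the interval, too. The same
  argument, upside down, applies to the highest block. Without \<open>top_first\<close> a child that is itself
  an increasing arrangement of blocks would create further intervals.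
\<close>

lemma linear_value_intervals:
  assumes "k > 0" and mono_pattern: "\<And>i j. \<pi> i < \<pi> j \<longleftrightarrow> i < j"
    and top_first: "\<And>i. i < k \<Longrightarrow> c (Suc i) \<ge> c i + 2 \<Longrightarrow> T i (c (Suc i) - 1) < T i (c i)"
  shows "value_intervals \<tau> (c 0) (c k) = (\<Union>i<k. value_intervals (T i) (c i) (c (Suc i))) \<union> node_intervals Linear c k"
proof (rule value_intervals_decompose)
  show "(i, j) \<in> value_intervals \<pi> 0 k" if "i < j" "j \<le> k" for i j
    by (rule value_intervalsI) (use that mono_pattern in auto)
  fix x y i j
  assume V: "(x, y) \<in> value_intervals \<tau> (c 0) (c k)"
    and ij: "i < j" "j < k" "c i \<le> x" "x < c (Suc i)" "c j < y" "y \<le> c (Suc j)"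
  note b = value_intervals_bounds[OF V]
  have ik: "i < k" using ij by simp
  have le: "c (Suc i) \<le> c j" using c_less(2)[of "Suc i" j] ij by simp
  have top_bottom: "\<tau> (c (Suc l) - 1) < \<tau> (c l)" if "l < k" "c (Suc l) \<ge> c l + 2" for l
    using same_block[OF that(1), of "c (Suc l) - 1" "c l"] top_first[OF that] that(2) by simp
  have "x = c i"
  proof (rule ccontr)
    assume "x \<noteq> c i"
    then have "\<tau> (c (Suc i) - 1) < \<tau> (c i)" using top_bottom[OF ik] ij by simp
    moreover have "\<tau> (c i) < \<tau> (c j)"
      using other_block[OF ik ij(2), of "c i" "c j"] block_le[OF ik] block_le[OF ij(2)] ij(1) mono_pattern by simp
    ultimately have "x \<le> c i"
      using value_intervals_convex[OF V, of "c i" "c (Suc i) - 1" "c j"] ij le block_le[OF ik] by simp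
    then show False using \<open>x \<noteq> c i\<close> ij by simp
  qed
  moreover have "y = c (Suc j)"
  proof (rule ccontr)
    assume "y \<noteq> c (Suc j)"
    then have "\<tau> (c (Suc j) - 1) < \<tau> (c j)" using top_bottom[OF ij(2)] ij by simp
    moreover have "\<tau> x < \<tau> (c (Suc j) - 1)"
      using other_block[OF ik ij(2), of x "c (Suc j) - 1"] block_le[OF ij(2)] ij mono_pattern by auto
    ultimately have "c (Suc j) - 1 < y"
      using value_intervals_convex[OF V, of "c (Suc j) - 1" x "c j"] ij le b block_le[OF ij(2)] by simp
    then show False using \<open>y \<noteq> c (Suc j)\<close> ij by simp
  qed
  moreover have "i < Suc j" "Suc j \<le> k" using ij by simp_all
  ultimately show "(x, y) \<in> node_intervals Linear c k" unfolding node_intervals.simps by blast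
qed (use assms in simp)

end

text \<open>
  Lexicographic comparison, first by the block and then inside the block, packed into one number:
  \<open>M\<close> exceeds all values of the \<open>T i\<close>.
\<close>

lemma ex_inflation:
  assumes mono: "strict_mono_on {..k} c" and "inj_on \<pi> {0..<k}"
    and "\<And>i. i < k \<Longrightarrow> inj_on (T i) {c i..<c (Suc i)}"
  shows "\<exists>\<tau>. inflation k c \<pi> T \<tau>"
proof -
  define idx where "idx x = (LEAST i. x < c (Suc i))" for x
  have idx: "idx x = i" if "i < k" "x \<in> {c i..<c (Suc i)}" for i x
    unfolding idx_def
  proof (rule Least_equality)
    show "x < c (Suc i)" using that by simp
    fix j assume j: "x < c (Suc j)"
    show "i \<le> j"
    proof (rule ccontr)
      assume "\<not> i \<le> j"
      then have "c (Suc j) \<le> c i" using strict_mono_on_less_iff(2)[OF mono, of "Suc j" i] that by simp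
      then show False using j that by simp
    qed
  qed
  define M where "M = Suc (\<Sum>i<k. \<Sum>x\<in>{c i..<c (Suc i)}. T i x)"
  have M: "T i x < M" if "i < k" "x \<in> {c i..<c (Suc i)}" for i x
  proof -
    have "T i x \<le> (\<Sum>x\<in>{c i..<c (Suc i)}. T i x)" using that by (intro member_le_sum) auto
    also have "\<dots> \<le> (\<Sum>i<k. \<Sum>x\<in>{c i..<c (Suc i)}. T i x)"
      using that by (intro member_le_sum[of i _ "\<lambda>i. \<Sum>x\<in>{c i..<c (Suc i)}. T i x"]) auto
    finally show ?thesis by (simp add: M_def)
  qed
  define \<tau> where "\<tau> x = \<pi> (idx x) * M + T (idx x) x" for x
  have less: "p * M + s < q * M + t" if "p < q" "s < M" for p q s t :: nat
  proof -
    have "p * M + s < Suc p * M" using that by simp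
    also have "\<dots> \<le> q * M" using that by (intro mult_le_mono1) simp
    finally show ?thesis by simp
  qed
  have "inflation k c \<pi> T \<tau>"
  proof
    show "\<tau> x < \<tau> y \<longleftrightarrow> T i x < T i y" if "i < k" "x \<in> {c i..<c (Suc i)}" "y \<in> {c i..<c (Suc i)}" for i x y
      using idx[OF that(1,2)] idx[OF that(1,3)] by (simp add: \<tau>_def)
    show "\<tau> x < \<tau> y \<longleftrightarrow> \<pi> i < \<pi> j"
      if ij: "i < k" "j < k" "i \<noteq> j" "x \<in> {c i..<c (Suc i)}" "y \<in> {c j..<c (Suc j)}" for i j x y
    proof -
      have t: "\<tau> x = \<pi> i * M + T i x" "\<tau> y = \<pi> j * M + T j y"
        using idx[OF ij(1,4)] idx[OF ij(2,5)] by (simp_all add: \<tau>_def)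
      have "\<pi> i \<noteq> \<pi> j" using inj_onD[OF assms(2), of i j] ij by auto
      then show ?thesis
        using less[of "\<pi> i" "\<pi> j" "T i x" "T j y"] less[of "\<pi> j" "\<pi> i" "T j y" "T i x"]
          M[OF ij(1,4)] M[OF ij(2,5)] unfolding t by linarith
    qed
  qed (use assms in auto)
  then show ?thesis by blast
qed

text \<open>
  The last conjunct is what a linear parent asks of its children. Reversing an order does not change its
  intervals, and so one of the two orientations satisfies it.
\<close>

theorem ex_order_of_tree:
  assumes "valid t"
  shows "\<exists>\<tau>. inj_on \<tau> {a..<a + leaves t} \<and> value_intervals \<tau> a (a + leaves t) = tree_intervals t a \<and>
    (leaves t \<ge> 2 \<longrightarrow> \<tau> (a + leaves t - 1) < \<tau> a)"
  using assms
proof (induction t arbitrary: a)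
  case Leaf
  have "(a, Suc a) \<in> value_intervals \<tau> a (Suc a)" for \<tau>
    by (rule value_intervalsI) auto
  moreover have "(x, y) = (a, Suc a)" if "(x, y) \<in> value_intervals \<tau> a (Suc a)" for x y \<tau>
    using value_intervals_bounds[OF that] by simp
  ultimately have "value_intervals \<tau> a (Suc a) = {(a, Suc a)}" for \<tau>
    by (intro equalityI subrelI) (blast, auto)
  then show ?case by (intro exI[of _ id]) auto
next
  case (Node \<kappa> ts)
  note v = valid_NodeD[OF Node.prems]
  define k where "k = length ts"
  define c where "c = cut a ts"
  have mono: "strict_mono_on {..k} c" unfolding k_def c_def by (rule strict_mono_cut[OF v(1)])
  have k: "min_arity \<kappa> \<le> k" "2 \<le> k" using v by (simp_all add: k_def)
  have ends: "c 0 = a" "c k = a + leaves (Node \<kappa> ts)"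
    using cut_length[of a ts \<kappa>] by (simp_all add: c_def k_def)
  have "\<exists>\<tau>. inj_on \<tau> {c i..<c (Suc i)} \<and> value_intervals \<tau> (c i) (c (Suc i)) = tree_intervals (ts ! i) (c i) \<and>
      (c (Suc i) \<ge> c i + 2 \<longrightarrow> \<tau> (c (Suc i) - 1) < \<tau> (c i))" if "i < k" for i
    using Node.IH[of "ts ! i" "c i"] v(1) that by (simp add: cut_Suc c_def k_def)
  then obtain T where T: "\<And>i. i < k \<Longrightarrow> inj_on (T i) {c i..<c (Suc i)}"
      "\<And>i. i < k \<Longrightarrow> value_intervals (T i) (c i) (c (Suc i)) = tree_intervals (ts ! i) (c i)"
      "\<And>i. i < k \<Longrightarrow> c (Suc i) \<ge> c i + 2 \<Longrightarrow> T i (c (Suc i) - 1) < T i (c i)"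
    by metis
  define \<pi> where "\<pi> = (case \<kappa> of Linear \<Rightarrow> id | Prime \<Rightarrow> simple_order k)"
  have "inj_on \<pi> {0..<k}" using inj_simple_order by (cases \<kappa>) (simp_all add: \<pi>_def)
  from ex_inflation[OF mono this T(1)] obtain \<tau> where "inflation k c \<pi> T \<tau>" by blast
  then interpret inflation k c \<pi> T \<tau> .
  have "value_intervals \<tau> (c 0) (c k) = (\<Union>i<k. value_intervals (T i) (c i) (c (Suc i))) \<union> node_intervals \<kappa> c k"
  proof (cases \<kappa>)
    case Linear
    have "k > 0" using k by simp
    then show ?thesis unfolding Linear
      by (rule linear_value_intervals) (use T(3) in \<open>simp_all add: \<pi>_def Linear\<close>)
  next
    case Prime
    then have "k \<ge> 4" using k by simp
    then show ?thesis unfolding Prime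
      by (rule prime_value_intervals) (use simple_order_simple \<open>k \<ge> 4\<close> in \<open>simp add: \<pi>_def Prime\<close>)
  qed
  then have V: "value_intervals \<tau> (c 0) (c k) = tree_intervals (Node \<kappa> ts) a"
    unfolding tree_intervals_Node using T(2) by (simp add: c_def k_def)
  show ?case
  proof (cases "\<tau> (c k - 1) < \<tau> (c 0)")
    case True
    then show ?thesis using inj V ends by (intro exI[of _ \<tau>]) simp
  next
    case False
    have two: "c k \<ge> c 0 + 2" using leaves_Node[OF Node.prems] ends by simp
    then have "c k - 1 \<in> {c 0..<c k}" "c 0 \<in> {c 0..<c k}" "c k - 1 \<noteq> c 0" by auto
    then have "\<tau> (c k - 1) \<noteq> \<tau> (c 0)" using inj_onD[OF inj, of "c k - 1" "c 0"] by blast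
    with False have less: "\<tau> (c 0) < \<tau> (c k - 1)" by simp
    define M where "M = (\<Sum>x\<in>{c 0..<c k}. \<tau> x)"
    have M: "\<tau> x \<le> M" if "x \<in> {c 0..<c k}" for x
      unfolding M_def using that by (intro member_le_sum) auto
    have "inj_on (\<lambda>x. M - \<tau> x) {c 0..<c k}"
    proof (rule inj_onI)
      fix x y assume "x \<in> {c 0..<c k}" "y \<in> {c 0..<c k}" "M - \<tau> x = M - \<tau> y"
      then show "x = y" using M[of x] M[of y] inj_onD[OF inj, of x y] by simp
    qed
    moreover have "value_intervals (\<lambda>x. M - \<tau> x) (c 0) (c k) = tree_intervals (Node \<kappa> ts) a"
      using value_intervals_reverse[of "c 0" "c k" \<tau> M] M V by simp
    moreover have "M - \<tau> (c k - 1) < M - \<tau> (c 0)"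
    proof (rule diff_less_mono2[OF less])
      have "c k - 1 \<in> {c 0..<c k}" using two by auto
      from less M[OF this] show "\<tau> (c 0) < M" by simp
    qed
    ultimately show ?thesis using ends by (intro exI[of _ "\<lambda>x. M - \<tau> x"]) simp
  qed
qed

section \<open>From linear orders to interval posets\<close>

lemma value_intervals_cong:
  assumes "\<And>x y. x \<in> {a..<b} \<Longrightarrow> y \<in> {a..<b} \<Longrightarrow> \<tau> x < \<tau> y \<longleftrightarrow> \<tau>' x < \<tau>' y"
  shows "value_intervals \<tau> a b = value_intervals \<tau>' a b"
proof -
  have "(x, y) \<in> value_intervals f a b"
    if "(x, y) \<in> value_intervals g a b" and fg: "\<And>x y. x \<in> {a..<b} \<Longrightarrow> y \<in> {a..<b} \<Longrightarrow> f x < f y \<longleftrightarrow> g x < g y"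
    for f g :: "nat \<Rightarrow> nat" and x y
  proof (rule value_intervalsI)
    note b = value_intervals_bounds[OF that(1)]
    show "a \<le> x" "x < y" "y \<le> b" by (rule b)+
    fix z u v assume "a \<le> z" "z < b" "x \<le> u" "u < y" "x \<le> v" "v < y" "f u < f z" "f z < f v"
    then show "x \<le> z \<and> z < y"
      using value_intervals_convex[OF that(1), of z u v] fg[of u z] fg[of z v] b by simp
  qed
  then show ?thesis using assms by (intro equalityI subrelI) blast+
qed

text \<open>
  \<open>inv \<sigma>\<close> maps values to positions, and a set of positions without gaps is an interval of positions.
\<close>

lemma intervals_conv_value_intervals:
  assumes \<sigma>: "\<sigma> permutes {1..n}"
  shows "intervals n \<sigma> = (\<lambda>(x, y). {x..<y}) ` value_intervals (inv \<sigma>) 1 (Suc n)"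
proof (intro equalityI subsetI)
  note inv = permutes_inverses[OF \<sigma>]
  have inv_in: "inv \<sigma> x \<in> {1..n} \<longleftrightarrow> x \<in> {1..n}" for x
    by (rule permutes_in_image[OF permutes_inv[OF \<sigma>]])
  {
    fix I assume "I \<in> intervals n \<sigma>"
    then obtain i j h where I: "I = {j..j + h}" "1 \<le> i" "i + h \<le> n" "\<sigma> ` {i..i + h} = {j..j + h}"
      by (auto simp: intervals_def)
    have iff: "inv \<sigma> x \<in> {i..i + h} \<longleftrightarrow> x \<in> {j..j + h}" for x
      using I(4) inv by (metis imageE imageI)
    have "{j..j + h} \<subseteq> {1..n}"
      unfolding I(4)[symmetric]
    proof (rule image_subsetI)
      fix p assume "p \<in> {i..i + h}"
      then have "p \<in> {1..n}" using I(2,3) by auto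
      then show "\<sigma> p \<in> {1..n}" using permutes_in_image[OF \<sigma>] by blast
    qed
    then have j: "1 \<le> j" "j + h \<le> n" by auto
    have "(j, Suc (j + h)) \<in> value_intervals (inv \<sigma>) 1 (Suc n)"
    proof (rule value_intervalsI)
      fix z u v assume "j \<le> u" "u < Suc (j + h)" "j \<le> v" "v < Suc (j + h)" and less: "inv \<sigma> u < inv \<sigma> z" "inv \<sigma> z < inv \<sigma> v"
      then have "inv \<sigma> u \<in> {i..i + h}" "inv \<sigma> v \<in> {i..i + h}" unfolding iff by simp_all
      then have "inv \<sigma> z \<in> {i..i + h}" using less by simp
      then show "j \<le> z \<and> z < Suc (j + h)" unfolding iff by simp
    qed (use j in auto)
    then show "I \<in> (\<lambda>(x, y). {x..<y}) ` value_intervals (inv \<sigma>) 1 (Suc n)"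
      by (rule rev_image_eqI) (simp add: I(1) atLeastLessThanSuc_atLeastAtMost)
  next
    fix I assume "I \<in> (\<lambda>(x, y). {x..<y}) ` value_intervals (inv \<sigma>) 1 (Suc n)"
    then obtain x y where V: "(x, y) \<in> value_intervals (inv \<sigma>) 1 (Suc n)" and I: "I = {x..<y}" by auto
    note b = value_intervals_bounds[OF V]
    define S where "S = inv \<sigma> ` {x..<y}"
    have S: "finite S" "S \<noteq> {}" using b by (auto simp: S_def)
    have sub: "S \<subseteq> {1..n}"
      unfolding S_def
    proof (rule image_subsetI)
      fix u assume "u \<in> {x..<y}"
      then have "u \<in> {1..n}" using b by auto
      then show "inv \<sigma> u \<in> {1..n}" using inv_in by blast
    qed
    have "S = {Min S..Max S}"
    proof (intro equalityI subsetI)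
      fix p assume p: "p \<in> {Min S..Max S}"
      show "p \<in> S"
      proof (cases "p = Min S \<or> p = Max S")
        case True
        then show ?thesis using Min_in[OF S] Max_in[OF S] by auto
      next
        case False
        obtain u where u: "x \<le> u" "u < y" "Min S = inv \<sigma> u" using Min_in[OF S] by (auto simp: S_def)
        obtain v where v: "x \<le> v" "v < y" "Max S = inv \<sigma> v" using Max_in[OF S] by (auto simp: S_def)
        have less: "inv \<sigma> u < inv \<sigma> (\<sigma> p)" "inv \<sigma> (\<sigma> p) < inv \<sigma> v"
          using False p u v inv(2)[of p] by auto
        have "p \<in> {1..n}" using p sub Min_in[OF S] Max_in[OF S] by fastforce
        then have "\<sigma> p \<in> {1..n}" using permutes_in_image[OF \<sigma>] by blast
        then have "x \<le> \<sigma> p \<and> \<sigma> p < y"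
          using value_intervals_convex[OF V _ _ u(1,2) v(1,2) less] by simp
        then show ?thesis unfolding S_def using inv(2)[of p] by (metis atLeastLessThan_iff imageI)
      qed
    qed (use S in auto)
    moreover have "card S = y - x"
      unfolding S_def using card_image[OF inj_on_subset[OF permutes_inj[OF permutes_inv[OF \<sigma>]] subset_UNIV], of "{x..<y}"] by simp
    ultimately have "Suc (Max S) - Min S = y - x" by (metis card_atLeastAtMost)
    moreover have "Min S \<le> Max S" using S by simp
    ultimately have Max: "Max S = Min S + (y - 1 - x)" using b by linarith
    have "\<sigma> ` S = {x..<y}" unfolding S_def image_image using inv(1) by simp
    then have "\<sigma> ` {Min S..Min S + (y - 1 - x)} = {x..x + (y - 1 - x)}"
      using \<open>S = {Min S..Max S}\<close> Max b by (auto simp: atLeastLessThanSuc_atLeastAtMost[symmetric] Suc_diff_Suc)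
    moreover have "1 \<le> Min S" "Max S \<le> n" using sub Min_in[OF S] Max_in[OF S] by auto
    moreover have "I = {x..x + (y - 1 - x)}" using I b by auto
    ultimately show "I \<in> intervals n \<sigma>" unfolding intervals_def mem_Collect_eq Max by blast
  }
qed

text \<open>
  The permutation places each value at its rank in the given order.
\<close>

lemma ex_permutation_of_order:
  assumes inj: "inj_on \<tau> {1..<Suc n}"
  shows "\<exists>\<sigma>. \<sigma> permutes {1..n} \<and> value_intervals (inv \<sigma>) 1 (Suc n) = value_intervals \<tau> 1 (Suc n)"
proof -
  let ?S = "{1..n}"
  have S: "{1..<Suc n} = ?S" by auto
  define r where "r x = (if x \<in> ?S then card {v \<in> ?S. \<tau> v \<le> \<tau> x} else x)" for x
  have less: "r x < r y" if "x \<in> ?S" "y \<in> ?S" "\<tau> x < \<tau> y" for x y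
  proof -
    have "y \<in> {v \<in> ?S. \<tau> v \<le> \<tau> y}" "y \<notin> {v \<in> ?S. \<tau> v \<le> \<tau> x}"
      "{v \<in> ?S. \<tau> v \<le> \<tau> x} \<subseteq> {v \<in> ?S. \<tau> v \<le> \<tau> y}"
      using that by auto
    then have "{v \<in> ?S. \<tau> v \<le> \<tau> x} \<subset> {v \<in> ?S. \<tau> v \<le> \<tau> y}" by blast
    then have "card {v \<in> ?S. \<tau> v \<le> \<tau> x} < card {v \<in> ?S. \<tau> v \<le> \<tau> y}" by (intro psubset_card_mono) auto
    then show ?thesis using that by (simp add: r_def)
  qed
  have neq: "\<tau> x \<noteq> \<tau> y" if "x \<in> ?S" "y \<in> ?S" "x \<noteq> y" for x y
    using inj_onD[OF inj] that unfolding S by blast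
  have less_iff: "r x < r y \<longleftrightarrow> \<tau> x < \<tau> y" if "x \<in> ?S" "y \<in> ?S" for x y
    using less neq that by (metis order_less_asym nat_neq_iff)
  have "inj_on r ?S"
  proof (rule inj_onI)
    fix x y assume "x \<in> ?S" "y \<in> ?S" "r x = r y"
    then show "x = y" using less_iff[of x y] less_iff[of y x] neq[of x y] by auto
  qed
  moreover have "r ` ?S \<subseteq> ?S"
  proof
    fix p assume "p \<in> r ` ?S"
    then obtain x where x: "x \<in> ?S" "p = card {v \<in> ?S. \<tau> v \<le> \<tau> x}" by (auto simp: r_def)
    have "card {v \<in> ?S. \<tau> v \<le> \<tau> x} \<le> card ?S" by (intro card_mono) auto
    moreover have "card {v \<in> ?S. \<tau> v \<le> \<tau> x} > 0" using x by (subst card_gt_0_iff) auto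
    ultimately show "p \<in> ?S" using x by simp
  qed
  ultimately have "bij_betw r ?S ?S" by (simp add: endo_inj_surj bij_betw_def)
  then have r: "r permutes ?S" by (rule bij_imp_permutes) (simp add: r_def del: atLeastAtMost_iff)
  have "value_intervals (inv (inv r)) 1 (Suc n) = value_intervals \<tau> 1 (Suc n)"
    unfolding permutes_inv_inv[OF r] by (rule value_intervals_cong) (use less_iff in \<open>simp add: S\<close>)
  then show ?thesis using permutes_inv[OF r] by blast
qed

definition trees :: "nat \<Rightarrow> dtree set" where
  "trees n = {t. valid t \<and> leaves t = n}"

lemma intervals_of_permutations:
  assumes "n \<ge> 1"
  shows "{intervals n \<sigma> | \<sigma>. \<sigma> permutes {1..n}}
       = (\<lambda>F. (\<lambda>(x, y). {x..<y}) ` F) ` (\<lambda>t. tree_intervals t 1) ` trees n" (is "?L = ?R")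
proof (intro equalityI subsetI)
  fix I assume "I \<in> ?L"
  then obtain \<sigma> where \<sigma>: "\<sigma> permutes {1..n}" "I = intervals n \<sigma>" by blast
  have "interval_system (value_intervals (inv \<sigma>) 1 (Suc n)) 1 (Suc n)"
    by (rule value_intervals_system) (use assms permutes_inj_on[OF permutes_inv[OF \<sigma>(1)]] in auto)
  from interval_system_ex_tree[OF this] obtain t where
    "valid t" "leaves t = n" "tree_intervals t 1 = value_intervals (inv \<sigma>) 1 (Suc n)" by auto
  then show "I \<in> ?R"
    using \<sigma> intervals_conv_value_intervals[OF \<sigma>(1)] by (auto simp: trees_def intro!: imageI)
next
  fix I assume "I \<in> ?R"
  then obtain t where t: "valid t" "leaves t = n" "I = (\<lambda>(x, y). {x..<y}) ` tree_intervals t 1"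
    by (auto simp: trees_def)
  obtain \<tau> where \<tau>: "inj_on \<tau> {1..<Suc n}" "value_intervals \<tau> 1 (Suc n) = tree_intervals t 1"
    using ex_order_of_tree[OF t(1), of 1] t(2) by auto
  obtain \<sigma> where "\<sigma> permutes {1..n}" "value_intervals (inv \<sigma>) 1 (Suc n) = value_intervals \<tau> 1 (Suc n)"
    using ex_permutation_of_order[OF \<tau>(1)] by blast
  then show "I \<in> ?L" using intervals_conv_value_intervals[of \<sigma> n] \<tau>(2) t(3) by auto
qed

lemma inj_on_tree_intervals: "inj_on (\<lambda>t. tree_intervals t a) (trees n)"
  by (rule inj_onI) (auto simp: trees_def intro: tree_intervals_inject)

lemma card_intervals_of_permutations:
  assumes "n \<ge> 1"
  shows "card {intervals n \<sigma> | \<sigma>. \<sigma> permutes {1..n}} = card (trees n)"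
proof -
  have "inj_on (\<lambda>(x, y). {x..<y}) {(x, y). x < (y :: nat)}"
    by (rule inj_onI) (auto simp: atLeastLessThan_inj)
  moreover have "(\<lambda>t. tree_intervals t 1) ` trees n \<subseteq> Pow {(x, y). x < y}"
    using tree_intervals_bounds by (fastforce simp: trees_def)
  ultimately have "inj_on (\<lambda>F. (\<lambda>(x, y). {x..<y}) ` F) ((\<lambda>t. tree_intervals t 1) ` trees n)"
    by (intro inj_on_subset[OF inj_on_image_Pow])
  then show ?thesis
    unfolding intervals_of_permutations[OF assms] by (simp add: card_image inj_on_tree_intervals)
qed

lemma Field_poset_of_intervals: "Field (poset_of_intervals n \<sigma>) = intervals n \<sigma>"
  by (auto simp: Field_def poset_of_intervals_def)

lemma card_minimal_elements:
  assumes \<sigma>: "\<sigma> permutes {1..n}"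
  shows "card (minimal_elements (poset_of_intervals n \<sigma>)) = n"
proof -
  have singleton: "{j} \<in> intervals n \<sigma>" if "j \<in> {1..n}" for j
  proof -
    have "inv \<sigma> j \<in> {1..n}" using that permutes_in_image[OF permutes_inv[OF \<sigma>]] by blast
    then show ?thesis
      unfolding intervals_def using permutes_inverses(1)[OF \<sigma>, of j]
      by (intro CollectI exI[of _ "inv \<sigma> j"] exI[of _ j] exI[of _ 0]) auto
  qed
  have bounds: "\<exists>j h. I = {j..j + h} \<and> j \<in> {1..n}" if "I \<in> intervals n \<sigma>" for I
  proof -
    obtain i j h where I: "I = {j..j + h}" "1 \<le> i" "i + h \<le> n" "\<sigma> ` {i..i + h} = {j..j + h}"
      using \<open>I \<in> intervals n \<sigma>\<close> by (auto simp: intervals_def)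
    then obtain p where p: "p \<in> {i..i + h}" "j = \<sigma> p" by (metis atLeastAtMost_iff imageE le_add1 le_refl)
    then have "p \<in> {1..n}" using I by auto
    then have "j \<in> {1..n}" using p permutes_in_image[OF \<sigma>] by blast
    then show ?thesis using I by blast
  qed
  have "minimal_elements (poset_of_intervals n \<sigma>) = (\<lambda>j. {j}) ` {1..n}"
  proof (intro equalityI subsetI)
    fix I assume I: "I \<in> minimal_elements (poset_of_intervals n \<sigma>)"
    then have "I \<in> intervals n \<sigma>" by (simp add: minimal_elements_def Field_poset_of_intervals)
    then obtain j h where j: "I = {j..j + h}" "j \<in> {1..n}" using bounds by blast
    then have "({j}, I) \<in> poset_of_intervals n \<sigma>"
      using singleton[of j] \<open>I \<in> intervals n \<sigma>\<close> by (simp add: poset_of_intervals_def)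
    then have "I = {j}" using I by (auto simp: minimal_elements_def)
    then show "I \<in> (\<lambda>j. {j}) ` {1..n}" using j by blast
  next
    fix I assume "I \<in> (\<lambda>j. {j}) ` {1..n}"
    then obtain j where j: "I = {j}" "j \<in> {1..n}" by blast
    have "J = {j}" if "(J, {j}) \<in> poset_of_intervals n \<sigma>" for J
    proof -
      have "J \<subseteq> {j}" "J \<noteq> {}" using that bounds[of J] by (auto simp: poset_of_intervals_def)
      then show ?thesis by blast
    qed
    then show "I \<in> minimal_elements (poset_of_intervals n \<sigma>)"
      using j singleton by (simp add: minimal_elements_def Field_poset_of_intervals)
  qed
  then show ?thesis by (simp add: card_image)
qed

text \<open>
  A poset of intervals is determined by its underlying set, because its order is inclusion.
\<close>

lemma num_interval_posets_eq_card_trees: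
  assumes "n \<ge> 1"
  shows "num_interval_posets n = card (trees n)"
proof -
  let ?R = "{r. interval_poset r \<and> card (minimal_elements r) = n}"
  have R: "?R = {poset_of_intervals n \<sigma> | \<sigma>. \<sigma> permutes {1..n}}"
  proof (intro equalityI subsetI)
    fix r assume r: "r \<in> ?R"
    then obtain m \<sigma> where \<sigma>: "\<sigma> permutes {1..m}" "r = poset_of_intervals m \<sigma>"
      by (auto simp: interval_poset_def)
    then have "m = n" using r card_minimal_elements[OF \<sigma>(1)] by simp
    then show "r \<in> {poset_of_intervals n \<sigma> | \<sigma>. \<sigma> permutes {1..n}}" using \<sigma> by blast
  qed (use card_minimal_elements in \<open>auto simp: interval_poset_def\<close>)
  have r_eq: "r = {(I, J). I \<in> Field r \<and> J \<in> Field r \<and> I \<subseteq> J}" if "r \<in> ?R" for r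
    using that unfolding R by (auto simp: Field_poset_of_intervals) (auto simp: poset_of_intervals_def)
  have "inj_on Field ?R"
  proof (rule inj_onI)
    fix r s assume rs: "r \<in> ?R" "s \<in> ?R" and eq: "Field r = Field s"
    show "r = s" by (subst r_eq[OF rs(1)], subst r_eq[OF rs(2)]) (simp only: eq)
  qed
  then have "card ?R = card (Field ` ?R)" by (simp add: card_image)
  also have "Field ` ?R = {intervals n \<sigma> | \<sigma>. \<sigma> permutes {1..n}}"
    unfolding R by (simp add: setcompr_eq_image image_image Field_poset_of_intervals)
  finally show ?thesis
    using card_intervals_of_permutations[OF assms] by (simp add: num_interval_posets_def)
qed

section \<open>Lagrange inversion and the closed form\<close>

unbundle fps_syntax

lemma fps_nth_compose_mult:
  fixes a b c :: "'a::idom fps"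
  assumes "b $ 0 = 0"
  shows "((a oo b) * c) $ N = (\<Sum>i = 0..N. a $ i * (b ^ i * c) $ N)"
proof -
  have "((a oo b) * c) $ N = (\<Sum>j = 0..N. (\<Sum>i = 0..j. a $ i * (b ^ i) $ j) * c $ (N - j))"
    by (simp add: fps_mult_nth fps_compose_nth)
  also have "\<dots> = (\<Sum>j = 0..N. (\<Sum>i = 0..N. a $ i * (b ^ i) $ j) * c $ (N - j))"
  proof (rule sum.cong[OF refl], rule arg_cong2[where f = "(*)", OF _ refl])
    fix j assume "j \<in> {0..N}"
    then show "(\<Sum>i = 0..j. a $ i * (b ^ i) $ j) = (\<Sum>i = 0..N. a $ i * (b ^ i) $ j)"
      by (intro sum.mono_neutral_left) (auto simp: startsby_zero_power_prefix[OF assms])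
  qed
  also have "\<dots> = (\<Sum>i = 0..N. a $ i * (\<Sum>j = 0..N. (b ^ i) $ j * c $ (N - j)))"
    unfolding sum_distrib_left sum_distrib_right
    by (subst sum.swap) (simp add: mult.assoc)
  finally show ?thesis by (simp add: fps_mult_nth)
qed

text \<open>
  With \<open>A = X \<psi>\<close>, the series is \<open>X\<^bsup>i+m+1\<^esup> A' / A\<^bsup>m+1\<^esup>\<close>, so the coefficient is the residue of
  \<open>A' / A\<^bsup>m+1\<^esup>\<close>. For \<open>m > 0\<close> this is the derivative of \<open>- 1 / (m A\<^sup>m)\<close>, whose residue
  vanishes; for \<open>m = 0\<close> it is the order 1 of the zero of \<open>A\<close>. The proof carries this out without Laurent series.
\<close>

lemma residue_of_power_times_derivative:
  fixes \<psi> :: "'a::field_char_0 fps"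
  assumes "\<psi> $ 0 \<noteq> 0"
  shows "((fps_X * \<psi>) ^ i * (inverse \<psi> ^ (i + m + 1) * fps_deriv (fps_X * \<psi>))) $ (i + m)
           = (if m = 0 then 1 else 0)"
proof -
  let ?\<phi> = "inverse \<psi>"
  have inv: "\<psi> * ?\<phi> = 1" "?\<phi> * \<psi> = 1"
    using assms by (simp_all add: inverse_mult_eq_1 inverse_mult_eq_1')
  have "(\<psi> * ?\<phi>) ^ i = 1" by (simp add: inv)
  then have cancel: "\<psi> ^ i * (?\<phi> ^ i * G) = G" for G
    by (simp add: power_mult_distrib flip: mult.assoc)
  have "(fps_X * \<psi>) ^ i * (?\<phi> ^ (i + m + 1) * fps_deriv (fps_X * \<psi>))
      = fps_X ^ i * (\<psi> ^ i * (?\<phi> ^ i * (?\<phi> ^ m * (?\<phi> * (\<psi> + fps_X * fps_deriv \<psi>)))))"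
    by (simp add: power_mult_distrib power_add algebra_simps)
  also have "\<dots> = fps_X ^ i * (?\<phi> ^ m * (?\<phi> * \<psi>) + fps_X * (?\<phi> ^ Suc m * fps_deriv \<psi>))"
    unfolding cancel by (simp add: algebra_simps)
  finally have eq: "(fps_X * \<psi>) ^ i * (?\<phi> ^ (i + m + 1) * fps_deriv (fps_X * \<psi>))
      = fps_X ^ i * (?\<phi> ^ m + fps_X * (?\<phi> ^ Suc m * fps_deriv \<psi>))"
    by (simp add: inv)
  show ?thesis
  proof (cases m)
    case 0
    then show ?thesis unfolding eq by (simp add: fps_X_power_mult_nth)
  next
    case (Suc l)
    have "fps_deriv (?\<phi> ^ m) = of_nat m * fps_deriv ?\<phi> * ?\<phi> ^ l"
      by (simp only: fps_deriv_power' Suc diff_Suc_1)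
    then have "fps_deriv (?\<phi> ^ m) = - of_nat m * (?\<phi> ^ Suc m * fps_deriv \<psi>)"
      using assms by (simp add: fps_inverse_deriv Suc power2_eq_square algebra_simps)
    moreover have "- of_nat m = (fps_const (- of_nat m) :: 'a fps)"
      by (simp flip: fps_of_nat fps_const_neg)
    ultimately have deriv: "fps_deriv (?\<phi> ^ m) = fps_const (- of_nat m) * (?\<phi> ^ Suc m * fps_deriv \<psi>)"
      by simp
    have "of_nat m * (?\<phi> ^ m) $ m = fps_deriv (?\<phi> ^ m) $ l"
      by (simp only: fps_deriv_nth Suc Suc_eq_plus1)
    also have "\<dots> = - of_nat m * (?\<phi> ^ Suc m * fps_deriv \<psi>) $ l"
      by (simp only: deriv fps_mult_left_const_nth)
    finally have "of_nat m * (?\<phi> ^ m) $ m = - of_nat m * (?\<phi> ^ Suc m * fps_deriv \<psi>) $ l" .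
    then have "(?\<phi> ^ m) $ m + (?\<phi> ^ Suc m * fps_deriv \<psi>) $ l = 0"
      using Suc by (simp del: of_nat_Suc power_Suc add: eq_neg_iff_add_eq_0 flip: distrib_left mult_minus_right)
    then show ?thesis unfolding eq by (simp add: fps_X_power_mult_nth Suc del: power_Suc)
  qed
qed

text \<open>
  \<open>P\<close> is also inverse to \<open>A = X \<psi>\<close> from the other side, so differentiating \<open>P \<circ> A = X\<close> gives
  \<open>(P' \<circ> A) A' = 1\<close>. In the expansion of \<open>(P' \<circ> A) A' \<psi>\<^bsup>-n\<^esup>\<close> in powers of \<open>A\<close>, only the term
  with \<open>A\<^bsup>n-1\<^esup>\<close> contributes to the coefficient of \<open>X\<^bsup>n-1\<^esup>\<close>.
\<close>

theorem Lagrange_inversion: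
  fixes P \<psi> :: "'a::field_char_0 fps"
  assumes "\<psi> $ 0 \<noteq> 0" and "P $ 0 = 0" and "(fps_X * \<psi>) oo P = fps_X" and "n > 0"
  shows "of_nat n * P $ n = (inverse \<psi> ^ n) $ (n - 1)"
proof -
  let ?A = "fps_X * \<psi>"
  have A: "?A $ 0 = 0" "?A $ 1 \<noteq> 0" using assms by simp_all
  have "fps_inv ?A oo (?A oo P) = (fps_inv ?A oo ?A) oo P"
    by (rule fps_compose_assoc) (use assms A in simp_all)
  then have "P = fps_inv ?A"
    using assms fps_inv[OF A] by (simp add: fps_inv_def)
  then have "P oo ?A = fps_X" using fps_inv[OF A] by simp
  then have 1: "(fps_deriv P oo ?A) * fps_deriv ?A = 1"
    using fps_compose_deriv[OF A(1), of P] by simp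
  have "(inverse \<psi> ^ n) $ (n - 1) = ((fps_deriv P oo ?A) * (inverse \<psi> ^ n * fps_deriv ?A)) $ (n - 1)"
    using 1 by (simp add: mult.left_commute)
  also have "\<dots> = (\<Sum>i = 0..n - 1. fps_deriv P $ i * (?A ^ i * (inverse \<psi> ^ n * fps_deriv ?A)) $ (n - 1))"
    by (rule fps_nth_compose_mult) simp
  also have "\<dots> = (\<Sum>i = 0..n - 1. if i = n - 1 then fps_deriv P $ i else 0)"
  proof (rule sum.cong[OF refl])
    fix i assume i: "i \<in> {0..n - 1}"
    then have "n = i + (n - 1 - i) + 1" "n - 1 = i + (n - 1 - i)" using assms by auto
    then show "fps_deriv P $ i * (?A ^ i * (inverse \<psi> ^ n * fps_deriv ?A)) $ (n - 1)
             = (if i = n - 1 then fps_deriv P $ i else 0)"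
      using residue_of_power_times_derivative[OF assms(1), of i "n - 1 - i"] i by auto
  qed
  also have "\<dots> = fps_deriv P $ (n - 1)" by simp
  finally show ?thesis using assms by simp
qed

lemma nth_inverse_one_minus_X_power:
  assumes "i > 0"
  shows "(inverse ((1 - fps_X) ^ i) :: 'a::field_char_0 fps) $ m = of_nat ((i + m - 1) choose m)"
  using one_minus_const_fps_X_neg_power'[OF assms, of "1 :: 'a"] by simp

text \<open>
  The series \<open>V = (X + X\<^sup>3) / (1 - X)\<close>; the factor \<open>X\<close> is kept in front because powers
  of \<open>V\<close> are expanded.
\<close>

definition block_series :: "real fps" where
  "block_series = fps_X * (1 + fps_X ^ 2) * inverse (1 - fps_X)"

lemma nth_block_series_power:
  assumes "0 < i" "i < n"
  shows "(block_series ^ i) $ (n - 1)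
       = (\<Sum>k = 0..min i ((n - i - 1) div 2). real ((i choose k) * ((n - 2 * k - 2) choose (i - 1))))"
proof -
  have "(block_series ^ i) $ (n - 1) = (fps_X ^ i * ((1 + fps_X ^ 2) ^ i * inverse ((1 - fps_X) ^ i))) $ (n - 1)"
    by (simp only: block_series_def power_mult_distrib fps_inverse_power mult.assoc)
  also have "\<dots> = ((1 + fps_X ^ 2) ^ i * inverse ((1 - fps_X :: real fps) ^ i)) $ (n - 1 - i)"
    using assms by (simp add: fps_X_power_mult_nth)
  also have "(1 + fps_X ^ 2 :: real fps) ^ i = (\<Sum>k = 0..i. fps_const (of_nat (i choose k)) * fps_X ^ (2 * k))"
    by (subst add.commute, subst binomial_ring) (simp add: atLeast0AtMost power_mult fps_of_nat)
  also have "(\<dots> * inverse ((1 - fps_X) ^ i)) $ (n - 1 - i)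
      = (\<Sum>k = 0..i. (fps_const (of_nat (i choose k)) * (fps_X ^ (2 * k) * inverse ((1 - fps_X) ^ i))) $ (n - 1 - i))"
    by (simp add: sum_distrib_right fps_sum_nth mult.assoc)
  also have "\<dots> = (\<Sum>k = 0..i. if 2 * k \<le> n - 1 - i then
        real ((i choose k) * ((n - 2 * k - 2) choose (i - 1))) else 0)"
  proof (rule sum.cong[OF refl])
    fix k
    have "(i + (n - 1 - i - 2 * k) - 1) choose (n - 1 - i - 2 * k) = (n - 2 * k - 2) choose (i - 1)"
      if "2 * k \<le> n - 1 - i"
      using that assms binomial_symmetric[of "i - 1" "n - 2 * k - 2"]
      by (auto simp: algebra_simps numeral_2_eq_2)
    then show "(fps_const (of_nat (i choose k)) * (fps_X ^ (2 * k) * inverse ((1 - fps_X) ^ i))) $ (n - 1 - i)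
        = (if 2 * k \<le> n - 1 - i then real ((i choose k) * ((n - 2 * k - 2) choose (i - 1))) else 0)"
      using assms(1) by (simp add: fps_X_power_mult_nth nth_inverse_one_minus_X_power)
  qed
  also have "\<dots> = (\<Sum>k = 0..min i ((n - i - 1) div 2). real ((i choose k) * ((n - 2 * k - 2) choose (i - 1))))"
    by (rule sum.mono_neutral_cong_right) auto
  finally show ?thesis .
qed

definition num_node_types :: "nat \<Rightarrow> nat" where
  "num_node_types k = (if k \<ge> 4 then 2 else if k \<ge> 2 then 1 else 0)"

text \<open>
  The weights \<open>num_node_types\<close> have the generating function \<open>(X\<^sup>2 + X\<^sup>4) / (1 - X)\<close>: one linear node for
  each \<open>k \<ge> 2\<close> and one prime node for each \<open>k \<ge> 4\<close>.
\<close>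

lemma X_minus_node_series:
  "fps_X - Abs_fps (\<lambda>k. real (num_node_types k)) = fps_X * (1 - block_series)"
proof -
  have "(fps_X :: real fps) ^ 2 + fps_X ^ 4 = (1 - fps_X) * Abs_fps (\<lambda>k. real (num_node_types k))" (is "?l = ?r")
  proof (rule fps_ext)
    fix k show "?l $ k = ?r $ k"
      by (cases k) (auto simp: left_diff_distrib fps_X_power_nth num_node_types_def)
  qed
  then have "inverse (1 - fps_X) * ((1 - fps_X) * Abs_fps (\<lambda>k. real (num_node_types k)))
      = (fps_X ^ 2 + fps_X ^ 4) * inverse (1 - fps_X)"
    by (simp add: mult.commute)
  then have "Abs_fps (\<lambda>k. real (num_node_types k)) = (fps_X ^ 2 + fps_X ^ 4) * inverse (1 - fps_X)"
    by (simp add: inverse_mult_eq_1 flip: mult.assoc)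
  then show ?thesis
    by (simp add: block_series_def algebra_simps power2_eq_square numeral_eq_Suc)
qed

lemma nth_tree_series:
  fixes P :: "real fps"
  assumes "P = fps_X + (Abs_fps (\<lambda>k. real (num_node_types k)) oo P)" "P $ 0 = 0" "n > 1"
  shows "P $ n = 1 / real n *
       (\<Sum>i = 1..n - 1. \<Sum>k = 0..min i ((n - i - 1) div 2).
          real (((n + i - 1) choose i) * (i choose k) * ((n - 2 * k - 2) choose (i - 1))))"
proof -
  have "(fps_X - Abs_fps (\<lambda>k. real (num_node_types k))) oo P = fps_X"
    using assms(1,2) by (simp add: fps_compose_sub_distrib algebra_simps)
  then have comp: "(fps_X * (1 - block_series)) oo P = fps_X"
    by (simp only: X_minus_node_series)
  have b0: "block_series $ 0 = 0" by (simp add: block_series_def)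
  have "inverse (1 - block_series) ^ n = inverse ((1 - fps_X) ^ n) oo block_series"
    using b0 by (simp add: fps_inverse_compose fps_compose_power[symmetric] fps_compose_sub_distrib fps_inverse_power)
  also have "inverse ((1 - fps_X) ^ n) = Abs_fps (\<lambda>i. real ((n + i - 1) choose i))"
    using assms(3) by (intro fps_ext) (simp add: nth_inverse_one_minus_X_power)
  finally have pow: "inverse (1 - block_series) ^ n = Abs_fps (\<lambda>i. real ((n + i - 1) choose i)) oo block_series" .
  have "real n * P $ n = (inverse (1 - block_series) ^ n) $ (n - 1)"
    by (rule Lagrange_inversion) (use assms comp b0 in auto)
  also have "\<dots> = (\<Sum>i = 0..n - 1. real ((n + i - 1) choose i) * (block_series ^ i) $ (n - 1))"
    by (simp add: pow fps_compose_nth)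
  also have "\<dots> = (\<Sum>i = 1..n - 1. real ((n + i - 1) choose i) * (block_series ^ i) $ (n - 1))"
    using assms(3) by (intro sum.mono_neutral_right) (auto simp: not_less_eq_eq)
  also have "\<dots> = (\<Sum>i = 1..n - 1. \<Sum>k = 0..min i ((n - i - 1) div 2).
          real (((n + i - 1) choose i) * (i choose k) * ((n - 2 * k - 2) choose (i - 1))))"
    using assms(3) by (intro sum.cong refl) (subst nth_block_series_power, auto simp: sum_distrib_left mult.assoc)
  finally show ?thesis using assms(3) by (simp add: field_simps)
qed

section \<open>The generating function of decomposition trees\<close>

text \<open>
  The intervals of a tree with \<open>n\<close> leaves are pairs of numbers up to \<open>n\<close>, and they determine the tree.
\<close>

lemma finite_trees: "finite (trees n)"
proof (rule finite_imageD[OF _ inj_on_tree_intervals])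
  have "(\<lambda>t. tree_intervals t 0) ` trees n \<subseteq> Pow ({0..n} \<times> {0..n})"
    using tree_intervals_bounds by (fastforce simp: trees_def)
  then show "finite ((\<lambda>t. tree_intervals t 0) ` trees n)" by (rule finite_subset) simp
qed

definition forests :: "nat \<Rightarrow> nat \<Rightarrow> dtree list set" where
  "forests k n = {ts. length ts = k \<and> (\<forall>t \<in> set ts. valid t) \<and> sum_list (map leaves ts) = n}"

lemma length_forest_le: "ts \<in> forests k n \<Longrightarrow> k \<le> n"
proof (induction ts arbitrary: k n)
  case (Cons t ts)
  then have "ts \<in> forests (k - 1) (n - leaves t)" "leaves t \<ge> 1" "k \<ge> 1" "leaves t \<le> n"
    using leaves_pos[of t] by (auto simp: forests_def)
  then show ?case using Cons.IH[of "k - 1" "n - leaves t"] by linarith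
qed (simp add: forests_def)

lemma forests_0: "forests 0 n = (if n = 0 then {[]} else {})"
  by (auto simp: forests_def)

lemma forests_Suc:
  "forests (Suc k) n = (\<lambda>(m, t, ts). t # ts) ` (SIGMA m:{0..n}. trees m \<times> forests k (n - m))"
proof (intro equalityI subsetI)
  fix ts assume "ts \<in> forests (Suc k) n"
  then obtain t ts' where ts: "ts = t # ts'" "t \<in> trees (leaves t)" "ts' \<in> forests k (n - leaves t)" "leaves t \<le> n"
    by (auto simp: forests_def trees_def length_Suc_conv)
  then show "ts \<in> (\<lambda>(m, t, ts). t # ts) ` (SIGMA m:{0..n}. trees m \<times> forests k (n - m))"
    by (intro rev_image_eqI[of "(leaves t, t, ts')"]) auto
qed (auto simp: forests_def trees_def)

lemma finite_forests: "finite (forests k n)"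
  by (induction k arbitrary: n) (auto simp: forests_0 forests_Suc finite_trees)

lemma card_forests_Suc:
  "card (forests (Suc k) n) = (\<Sum>m = 0..n. card (trees m) * card (forests k (n - m)))"
proof -
  have "inj_on (\<lambda>(m, t, ts). t # ts) (SIGMA m:{0..n}. trees m \<times> forests k (n - m))"
    by (rule inj_onI) (auto simp: trees_def)
  then show ?thesis
    by (simp add: forests_Suc card_image card_SigmaI finite_trees finite_forests card_cartesian_product)
qed

definition tree_series :: "real fps" where
  "tree_series = Abs_fps (\<lambda>n. real (card (trees n)))"

lemma tree_series_power_nth: "(tree_series ^ k) $ n = real (card (forests k n))"
proof (induction k arbitrary: n)
  case (Suc k)
  then show ?case by (simp add: fps_mult_nth card_forests_Suc tree_series_def)
qed (simp add: forests_0)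

lemma card_node_kinds: "card {\<kappa>. min_arity \<kappa> \<le> k} = num_node_types k"
proof -
  have "{\<kappa>. min_arity \<kappa> \<le> k} = (if k \<ge> 4 then {Linear, Prime} else if k \<ge> 2 then {Linear} else {})"
  proof (intro equalityI subsetI)
    fix \<kappa> show "\<kappa> \<in> {\<kappa>. min_arity \<kappa> \<le> k} \<Longrightarrow> \<kappa> \<in> (if k \<ge> 4 then {Linear, Prime} else if k \<ge> 2 then {Linear} else {})"
      by (cases \<kappa>) auto
  qed (auto split: if_splits)
  then show ?thesis by (simp add: num_node_types_def)
qed

lemma trees_conv_forests:
  "trees n = (if n = 1 then {Leaf} else {}) \<union>
     (\<lambda>(k, \<kappa>, ts). Node \<kappa> ts) ` (SIGMA k:{0..n}. {\<kappa>. min_arity \<kappa> \<le> k} \<times> forests k n)" (is "_ = ?A \<union> ?B")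
proof (intro equalityI subsetI)
  fix t assume t: "t \<in> trees n"
  show "t \<in> ?A \<union> ?B"
  proof (cases t)
    case (Node \<kappa> ts)
    then have f: "ts \<in> forests (length ts) n" "min_arity \<kappa> \<le> length ts"
      using t by (simp_all add: trees_def forests_def)
    then have "t \<in> ?B"
      using length_forest_le[OF f(1)] Node by (intro rev_image_eqI[of "(length ts, \<kappa>, ts)"]) auto
    then show ?thesis ..
  qed (use t in \<open>simp add: trees_def\<close>)
qed (auto simp: trees_def forests_def split: if_splits)

lemma card_trees:
  "card (trees n) = (if n = 1 then 1 else 0) + (\<Sum>k = 0..n. num_node_types k * card (forests k n))"
proof -
  let ?S = "SIGMA k:{0..n}. {\<kappa>. min_arity \<kappa> \<le> k} \<times> forests k n"
  have inj: "inj_on (\<lambda>(k, \<kappa>, ts). Node \<kappa> ts) ?S"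
    by (rule inj_onI) (auto simp: forests_def)
  have fin_kinds: "finite (A :: node_kind set)" for A
  proof (rule finite_subset)
    show "A \<subseteq> {Linear, Prime}" using node_kind.exhaust by blast
  qed simp
  have fin: "finite ?S" using fin_kinds finite_forests by auto
  have "card (trees n) = card (if n = 1 then {Leaf} else {}) + card ((\<lambda>(k, \<kappa>, ts). Node \<kappa> ts) ` ?S)"
    unfolding trees_conv_forests[of n] by (rule card_Un_disjoint) (use fin in auto)
  also have "card ((\<lambda>(k, \<kappa>, ts). Node \<kappa> ts) ` ?S) = (\<Sum>k = 0..n. num_node_types k * card (forests k n))"
    using fin_kinds finite_forests
    by (simp add: card_image[OF inj] card_SigmaI card_cartesian_product card_node_kinds)
  finally show ?thesis by simp
qed

lemma tree_series_equation:
  "tree_series = fps_X + (Abs_fps (\<lambda>k. real (num_node_types k)) oo tree_series)"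
proof (rule fps_ext)
  fix n
  have "(Abs_fps (\<lambda>k. real (num_node_types k)) oo tree_series) $ n
      = real (\<Sum>k = 0..n. num_node_types k * card (forests k n))"
    by (simp add: fps_compose_nth tree_series_power_nth)
  moreover have "tree_series $ n = real (card (trees n))" by (simp add: tree_series_def)
  ultimately show "tree_series $ n = (fps_X + (Abs_fps (\<lambda>k. real (num_node_types k)) oo tree_series)) $ n"
    using card_trees[of n] by simp
qed

theorem theorem19:
  fixes n :: nat
  assumes "n \<ge> 1"
  shows "real (num_interval_posets n) =
    (if n = 1 then 1
     else 1 / real n *
       (\<Sum>i = 1..n - 1. \<Sum>k = 0..min i ((n - i - 1) div 2).
          real (((n + i - 1) choose i) * (i choose k) * ((n - 2 * k - 2) choose (i - 1)))))"
proof -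
  have series: "real (num_interval_posets n) = tree_series $ n"
    by (simp add: num_interval_posets_eq_card_trees[OF assms] tree_series_def)
  show ?thesis
  proof (cases "n = 1")
    case True
    have "trees 1 = {Leaf}"
    proof (intro equalityI subsetI)
      fix t assume "t \<in> trees 1"
      then show "t \<in> {Leaf}" using leaves_Node by (cases t) (force simp: trees_def)+
    qed (simp add: trees_def)
    then show ?thesis using True series by (simp add: tree_series_def)
  next
    case False
    have "trees 0 = {}" using leaves_pos by (force simp: trees_def)
    then have "tree_series $ 0 = 0" by (simp add: tree_series_def)
    then show ?thesis
      using nth_tree_series[OF tree_series_equation _, of n] series assms False by simp
  qed
qed

end
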